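(* (Muir's law.) Let $I=(i_1<\cdots<i_l)\subseteq[m+n]\setminus[m]$. Assume a minor identity for quantum Berezinians $$\sum_{i=1}^kb_i\prod_{j=1}^{m_i}\mathrm{Ber}_q(M_{I_{ij}})=0,$$ where $I_{ij}\subseteq I$ are increasing multi-indices and $b_i\in\mathbb{C}(q)$. Then the following identity holds: $$\sum_{i=1}^kb_i\prod_{j=1}^{m_i}\Big(\mathrm{Ber}_q(M_{I_{ij}\cup I^c})\,\mathrm{Ber}_q(M_{I^c})^{-1}\Big)=0,$$ where $I^c=[m+n]\setminus I$.
   Context: Here $q$ is the deformation parameter (an indeterminate; scalars in $\mathbb{C}(q)$), $m,n\ge0$ integers, $[k]=\{1,\dots,k\}$. An index $i\in[m+n]$ has parity $\bar i=0$ if $i\le m$ and $\bar i=1$ if $i>m$. Put $\varepsilon(a)=1,0,-1$ according to $a>0,a=0,a<0$. $l(\sigma)$ is the number of inversions of a permutation. A matrix $A=(A_{ij})_{i,j\in[m+n]}$ over a superalgebra, $A_{ij}$ of parity $\bar i+\bar j$, satisfies the relations $R^q$ (is a $q$-super Manin matrix of type $m|n$) if: (1) $A_{ij}^2=0$ if $\bar i=1,\bar j=0$; (2) $A_{ik}A_{il}=q^{\varepsilon(l-k)}(-1)^{(\bar k+1)(\bar l+1)}A_{il}A_{ik}$ if $\bar i=1$; (3) $A_{ik}A_{jk}=q^{\varepsilon(i-j)}(-1)^{\bar i\bar j}A_{jk}A_{ik}$ if $\bar k=0$; (4) for all $i,j,k,l$: $A_{ij}A_{kl}-q^{\varepsilon(i-k)+\varepsilon(l-j)}(-1)^{(\bar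 i+\bar j)(\bar k+\bar l)}A_{kl}A_{ij}=q^{\varepsilon(i-k)}(-1)^{\bar i\bar k+\bar j\bar k+\bar i\bar j}A_{kj}A_{il}-q^{\varepsilon(l-j)}(-1)^{\bar j\bar k+\bar j\bar l+\bar k\bar l}A_{il}A_{kj}$. The supertranspose is $(A^{st})_{ij}=(-1)^{\bar i(\bar i+\bar j)}A_{ji}$. $\widetilde{\mathcal{M}}_{m|n}$ is the unital associative superalgebra generated by the entries of two matrices $M$ and $M^{-1}$ ($(i,j)$ entries of parity $\bar i+\bar j$) subject to: $M$ satisfies $R^q$; $M^{-1}$ satisfies $R^{q^{-1}}$ (i.e. $R^q$ with $q$ replaced by $q^{-1}$); $MM^{-1}=M^{-1}M=1$; and $M^{st}(M^{-1})^{st}=(M^{-1})^{st}M^{st}=1$. $M$ is the generator matrix. A "minor identity for quantum Berezinians" is an identity of the displayed form for the generator matrix $M$, understood as a formal (universal) identity for quantum super Manin matrices. For an invertible matrix $A$ of type $r|s$ (first $r$ indices even, last $s$ odd) the quantum Berezinian is $$\mathrm{Ber}_q(A)=\sum_{\sigma\in\mathfrak{S}_r}(-q)^{-l(\sigma)}A_{\sigma(1),1}\cdots A_{\sigma(r),r}\times\sum_{\rho\in\mathfrak{S}_s}(-q)^{-l(\rho)}(A^{-1})_{r+1,r+\rho(1)}\cdots(A^{-1})_{r+s,r+\rho(s)}$$ (sums over $\mathfrak{S}_0$ equal $1$). For an increasing multi-index (subset) $K$ of $[m+n]$ with $r$ elements in $[m]$ and $s$ outside, $M_K$ is the submatrix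 of $M$ with row and column indices in $K$ (in increasing order), of type $r|s$. Products over $j$ are ordered, $j=1,\dots,m_i$. Standing conventions: all inverses of submatrices, quasideterminants and Berezinians that are needed are assumed to exist (in a suitable extension of $\widetilde{\mathcal{M}}_{m|n}$), and $M_K$ together with its inverse is regarded as the generator matrix of $\widetilde{\mathcal{M}}_{r|s}$ together with its antipode image (i.e. they satisfy the defining relations of $\widetilde{\mathcal{M}}_{r|s}$); likewise for principal submatrices of $M^{-1}$ with $q$ replaced by $q^{-1}$. *)

theory Defs
  imports
    Complex_Main
    "HOL-Computational_Algebra.Polynomial"
    "HOL-Computational_Algebra.Fraction_Field"
    "HOL-Combinatorics.Permutations"
    "HOL-Library.Poly_Mapping"
begin

section \<open>The field \<open>\<complex>(q)\<close> and free algebras over it\<close>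

type_synonym Cq = "complex poly fract"

definition q :: Cq where
  "q = Fract [:0, 1:] 1"

datatype 'g word = Word "'g list"

instantiation word :: (type) monoid_add
begin

definition zero_word :: "'a word" where
  "zero_word = Word []"

fun plus_word :: "'a word \<Rightarrow> 'a word \<Rightarrow> 'a word" where
  "plus_word (Word u) (Word v) = Word (u @ v)"

instance
proof
  fix a b c :: "'a word"
  show "a + b + c = a + (b + c)"
    by (cases a; cases b; cases c) simp
  show "0 + a = a"
    by (cases a) (simp add: zero_word_def)
  show "a + 0 = a"
    by (cases a) (simp add: zero_word_def)
qed

end

text \<open>The library's convolution product on finitely supported functions makes this the free
  unital associative algebra on \<open>'g\<close>: words are the (additively written) monoid of exponents.\<close>

type_synonym 'g free_alg = "'g word \<Rightarrow>\<^sub>0 Cq"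

definition gen :: "'g \<Rightarrow> 'g free_alg" where
  "gen x = Poly_Mapping.single (Word [x]) 1"

definition scal :: "Cq \<Rightarrow> 'g free_alg" where
  "scal c = Poly_Mapping.single 0 c"

inductive_set two_sided_ideal :: "'a::ring_1 set \<Rightarrow> 'a set" for S where
  zero: "0 \<in> two_sided_ideal S"
| base: "s \<in> S \<Longrightarrow> a * s * b \<in> two_sided_ideal S"
| add: "x \<in> two_sided_ideal S \<Longrightarrow> y \<in> two_sided_ideal S \<Longrightarrow> x + y \<in> two_sided_ideal S"

section \<open>The relations of \<open>q\<close>-super Manin matrices\<close>

text \<open>Matrices of type \<open>m|n\<close> are functions of which only the entries with indices in
  \<open>{1..m+n}\<close> matter. The parameter \<open>h\<close> stands for \<open>q\<close> or \<open>q\<^sup>-\<^sup>1\<close>.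
  Each relation \<open>x = y\<close> is recorded as the element \<open>x - y\<close>. All the relations
  below are homogeneous when the \<open>(i,j)\<close> entry has parity \<open>par m i + par m j\<close>, so every
  algebra they present is a superalgebra; the grading is not needed otherwise.\<close>

type_synonym 'a mat = "nat \<Rightarrow> nat \<Rightarrow> 'a"

definition par :: "nat \<Rightarrow> nat \<Rightarrow> nat" where
  "par m i = (if i \<le> m then 0 else 1)"

definition eps :: "nat \<Rightarrow> nat \<Rightarrow> int" where
  \<comment> \<open>\<open>\<epsilon>(a - b)\<close>, with the difference taken in the integers\<close>
  "eps a b = sgn (int a - int b)"

definition manin_rels :: "nat \<Rightarrow> nat \<Rightarrow> Cq \<Rightarrow> 'g free_alg mat \<Rightarrow> 'g free_alg set" where
  "manin_rels m n h A =
     {A i j * A i j | i j.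
        i \<in> {1..m+n} \<and> j \<in> {1..m+n} \<and> par m i = 1 \<and> par m j = 0}
   \<union> {A i k * A i l
        - scal (h powi eps l k * (-1) ^ ((par m k + 1) * (par m l + 1))) * (A i l * A i k) | i k l.
        i \<in> {1..m+n} \<and> k \<in> {1..m+n} \<and> l \<in> {1..m+n} \<and> par m i = 1}
   \<union> {A i k * A j k
        - scal (h powi eps i j * (-1) ^ (par m i * par m j)) * (A j k * A i k) | i j k.
        i \<in> {1..m+n} \<and> j \<in> {1..m+n} \<and> k \<in> {1..m+n} \<and> par m k = 0}
   \<union> {(A i j * A k l
        - scal (h powi (eps i k + eps l j)
                * (-1) ^ ((par m i + par m j) * (par m k + par m l))) * (A k l * A i j))
      - (scal (h powi eps i k
                * (-1) ^ (par m i * par m k + par m j * par m k + par m i * par m j))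
           * (A k j * A i l)
        - scal (h powi eps l j
                * (-1) ^ (par m j * par m k + par m j * par m l + par m k * par m l))
           * (A i l * A k j)) | i j k l.
        i \<in> {1..m+n} \<and> j \<in> {1..m+n} \<and> k \<in> {1..m+n} \<and> l \<in> {1..m+n}}"

definition supertranspose :: "nat \<Rightarrow> 'g free_alg mat \<Rightarrow> 'g free_alg mat" where
  "supertranspose m A = (\<lambda>i j. (-1) ^ (par m i * (par m i + par m j)) * A j i)"

definition inverse_rels :: "nat \<Rightarrow> 'g free_alg mat \<Rightarrow> 'g free_alg mat \<Rightarrow> 'g free_alg set" where
  "inverse_rels N A B =
     {(\<Sum>k=1..N. A i k * B k j) - (if i = j then 1 else 0) | i j. i \<in> {1..N} \<and> j \<in> {1..N}}
   \<union> {(\<Sum>k=1..N. B i k * A k j) - (if i = j then 1 else 0) | i j. i \<in> {1..N} \<and> j \<in> {1..N}}"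

text \<open>The defining relations of \<open>\<M>~\<^bsub>m|n\<^esub>\<close>, with \<open>q\<close> replaced by \<open>h\<close>, imposed on the pair of
  \<open>A\<close> and its inverse \<open>B\<close>.\<close>

definition tilde_rels ::
    "nat \<Rightarrow> nat \<Rightarrow> Cq \<Rightarrow> 'g free_alg mat \<Rightarrow> 'g free_alg mat \<Rightarrow> 'g free_alg set" where
  "tilde_rels m n h A B =
     manin_rels m n h A \<union> manin_rels m n (inverse h) B
   \<union> inverse_rels (m + n) A B
   \<union> inverse_rels (m + n) (supertranspose m A) (supertranspose m B)"

section \<open>Submatrices and quantum Berezinians\<close>

definition submat :: "nat set \<Rightarrow> 'a mat \<Rightarrow> 'a mat" where
  \<comment> \<open>rows and columns in \<open>K\<close>, in increasing order, renumbered from 1\<close>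
  "submat K A = (\<lambda>i j. A (sorted_list_of_set K ! (i - 1)) (sorted_list_of_set K ! (j - 1)))"

definition num_even :: "nat \<Rightarrow> nat set \<Rightarrow> nat" where
  "num_even m K = card (K \<inter> {1..m})"

definition num_odd :: "nat \<Rightarrow> nat set \<Rightarrow> nat" where
  "num_odd m K = card (K - {1..m})"

definition inversions :: "nat \<Rightarrow> (nat \<Rightarrow> nat) \<Rightarrow> nat" where
  "inversions r \<sigma> = card {(i, j). 1 \<le> i \<and> i < j \<and> j \<le> r \<and> \<sigma> i > \<sigma> j}"

definition Ber :: "nat \<Rightarrow> nat \<Rightarrow> 'g free_alg mat \<Rightarrow> 'g free_alg mat \<Rightarrow> 'g free_alg" where
  \<comment> \<open>the quantum Berezinian of the matrix \<open>A\<close> of type \<open>r|s\<close> with inverse \<open>B\<close>\<close>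
  "Ber r s A B =
     (\<Sum>\<sigma> | \<sigma> permutes {1..r}.
        scal ((- q) powi (- int (inversions r \<sigma>))) * (\<Prod>i\<leftarrow>[1..<Suc r]. A (\<sigma> i) i))
   * (\<Sum>\<rho> | \<rho> permutes {1..s}.
        scal ((- q) powi (- int (inversions s \<rho>))) * (\<Prod>i\<leftarrow>[1..<Suc s]. B (r + i) (r + \<rho> i)))"

section \<open>The generator matrix and the universal extension\<close>

text \<open>The identities live in the universal extension of \<open>\<M>~\<^bsub>m|n\<^esub>\<close> in which the standing
  conventions hold: besides the entries \<open>M i j\<close> of the generator matrix there are generators for
  the entries of the inverse of \<open>M\<^sub>K\<close> for every \<open>K \<subseteq> {1..m+n}\<close> (rows and columns renumbered from 1),
  of the inverse of every principal submatrix \<open>(M\<^sup>-\<^sup>1)\<^sub>K\<close>, and for the inverse of every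
  \<open>Ber(M\<^sub>K)\<close>. The inverse of \<open>M\<close> itself is the case \<open>K = {1..m+n}\<close>. Generators with indices out of
  range occur in no relation; sending them to 0 is a retraction, so their presence does not affect
  which identities hold between the others.\<close>

datatype generator =
    M_entry nat nat
  | M_sub_inv "nat set" nat nat
  | Minv_sub_inv "nat set" nat nat
  | Ber_inv "nat set"

definition M :: "generator free_alg mat" where
  "M i j = gen (M_entry i j)"

definition MsubInv :: "nat set \<Rightarrow> generator free_alg mat" where
  "MsubInv K i j = gen (M_sub_inv K i j)"

definition Minv :: "nat \<Rightarrow> nat \<Rightarrow> generator free_alg mat" where
  "Minv m n = MsubInv {1..m+n}"

definition MinvSubInv :: "nat set \<Rightarrow> generator free_alg mat" where
  "MinvSubInv K i j = gen (Minv_sub_inv K i j)"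

definition BerM :: "nat \<Rightarrow> nat set \<Rightarrow> generator free_alg" where
  "BerM m K = Ber (num_even m K) (num_odd m K) (submat K M) (MsubInv K)"

definition BerMInv :: "nat set \<Rightarrow> generator free_alg" where
  "BerMInv K = gen (Ber_inv K)"

definition universal_rels :: "nat \<Rightarrow> nat \<Rightarrow> generator free_alg set" where
  "universal_rels m n = (\<Union>K \<in> Pow {1..m+n}.
       tilde_rels (num_even m K) (num_odd m K) q (submat K M) (MsubInv K)
     \<union> tilde_rels (num_even m K) (num_odd m K) (inverse q) (submat K (Minv m n)) (MinvSubInv K)
     \<union> {BerM m K * BerMInv K - 1, BerMInv K * BerM m K - 1})"

definition holds_universally ::
    "nat \<Rightarrow> nat \<Rightarrow> generator free_alg \<Rightarrow> generator free_alg \<Rightarrow> bool" where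
  \<comment> \<open>\<open>x = y\<close> in the algebra presented by \<open>universal_rels m n\<close>\<close>
  "holds_universally m n x y \<longleftrightarrow> x - y \<in> two_sided_ideal (universal_rels m n)"

end

(* The index set I is odd, so all even indices lie in its complement C. Let N be the inverse of the
   block of M^{-1} on I, which is the Schur complement of M_C in M. For J inside I the inverse of N_J
   is the block on J of the inverse of M_{J \<union> C}. The odd factor of the Berezinian is a row
   determinant: the coefficient of the top monomial in a product of q-anticommuting linear forms, one
   for each row. Eliminating the rows in C by those in J factors it, whence
   Ber(M_{J \<union> C}) = Ber(M_C) Ber(N_J). So the products in the conclusion are those of the
   Ber(N_J), conjugated by the one element Ber(M_C).

   It remains to transfer the given identity from M to N. The matrix with the block N on I and
   commuting diagonal entries T_c outside I satisfies all the relations of M, provided that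
   T_c N_kl = q^(eps(c-k) + eps(l-c)) N_kl T_c. Such T_c exist as shifts on functions of d : nat -> int
   with values in the algebra, if N_kl acts at d as multiplication by q^(d_l - d_k) N_kl. Hence the
   generators of the universal algebra act on such functions, and Ber(M_J) acts through Ber(N_J). *)
theory Submission
  imports Defs "HOL-Combinatorics.Multiset_Permutations"
begin

section \<open>Algebras over the field of scalars\<close>

text \<open>All even indices lie in C, so the even factors of Ber(M_{J \<union> C}) and Ber(M_C) are
  the same sum and only the odd factors have to be compared. Scalars T_c would not do: for i = j = c
  and k, l in I the right side of relation (4) vanishes, as off-block entries are 0, and what
  remains is the stated commutation of T_c with N_kl. The weights d_l - d_k do no harm inside N: all
  terms of a quadratic relation have the same two rows and two columns, hence the same weight. In a
  determinant over J each index occurs once as a row and once as a column, so the weight is 0, and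
  Ber(N_J) is read off at d = 0 from the constant function 1. The assumed identity is accessible
  only through a homomorphism defined on all generators. Hence every submatrix, also one meeting
  both I and C, needs an inverse in the image, and so does every Berezinian; that invertibility
  comes from the factorization itself. The presented algebra and the operators over it are treated
  alike, hence a class of algebras with central scalars.\<close>

class cq_algebra = ring_1 +
  fixes sc :: "Cq \<Rightarrow> 'a"
  assumes sc_add: "sc (a + b) = sc a + sc b"
    and sc_mult: "sc (a * b) = sc a * sc b"
    and sc_1 [simp]: "sc 1 = 1"
    and sc_commute: "x * sc a = sc a * x"
begin

lemma sc_0 [simp]: "sc 0 = 0"
  using sc_add[of 0 0] by simp

lemma sc_minus: "sc (- a) = - sc a"
proof -
  have "sc a + sc (- a) = 0"
    by (simp flip: sc_add)
  then show ?thesis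
    by (rule minus_unique[symmetric])
qed

lemma sc_left_commute: "x * (sc a * y) = sc a * (x * y)"
  by (metis mult.assoc sc_commute)

lemma sc_sc_left: "sc a * (sc b * y) = sc (a * b) * y"
  by (simp add: mult.assoc sc_mult)

lemma sc_neg_one_power: "sc ((-1) ^ k) = (-1) ^ k"
  by (induction k) (simp_all add: sc_minus)

lemma sc_cancel: "a \<noteq> 0 \<Longrightarrow> sc a * x = sc a * y \<Longrightarrow> x = y"
  by (metis left_inverse mult_1_left sc_1 sc_sc_left)

end

lemma sc_mult_sc_mult: "(sc a * x) * (sc b * y) = sc (a * b) * (x * y)"
  for x y :: "'a::cq_algebra"
  by (metis mult.assoc sc_left_commute sc_mult)

lemma q_nonzero [simp]: "q \<noteq> 0"
  by (simp add: q_def eq_fract Zero_fract_def)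

definition alg_hom :: "('g free_alg \<Rightarrow> 'a::cq_algebra) \<Rightarrow> bool" where
  "alg_hom f \<longleftrightarrow> (\<forall>x y. f (x + y) = f x + f y) \<and> (\<forall>x y. f (x * y) = f x * f y)
     \<and> (\<forall>c. f (scal c) = sc c)"

context
  fixes f :: "'g free_alg \<Rightarrow> 'a::cq_algebra"
  assumes f: "alg_hom f"
begin

lemma alg_hom_add: "f (x + y) = f x + f y"
  and alg_hom_mult: "f (x * y) = f x * f y"
  and alg_hom_scal: "f (scal c) = sc c"
  using f by (auto simp: alg_hom_def)

lemma alg_hom_1: "f 1 = 1"
  using alg_hom_scal[of 1] by (simp add: scal_def)

lemma alg_hom_0: "f 0 = 0"
  using alg_hom_add[of 0 0] by simp

lemma alg_hom_diff: "f (x - y) = f x - f y"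
  using alg_hom_add[of "x - y" y] by simp

lemma alg_hom_minus: "f (- x) = - f x"
  using alg_hom_diff[of 0 x] alg_hom_0 by simp

lemma alg_hom_sum: "f (\<Sum>a\<in>A. g a) = (\<Sum>a\<in>A. f (g a))"
  by (induction A rule: infinite_finite_induct) (simp_all add: alg_hom_0 alg_hom_add)

lemma alg_hom_prod_list: "f (prod_list xs) = prod_list (map f xs)"
  by (induction xs) (simp_all add: alg_hom_1 alg_hom_mult)

lemma alg_hom_power: "f (x ^ k) = f x ^ k"
  by (induction k) (simp_all add: alg_hom_1 alg_hom_mult)

lemma alg_hom_ideal:
  assumes "\<And>s. s \<in> S \<Longrightarrow> f s = 0" "x \<in> two_sided_ideal S"
  shows "f x = 0"
  using assms(2) by induction (simp_all add: assms(1) alg_hom_0 alg_hom_add alg_hom_mult)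

end

section \<open>Universal property of the free algebra\<close>

fun letters :: "'g word \<Rightarrow> 'g list" where
  "letters (Word u) = u"

lemma letters_plus: "letters (u + v) = letters u @ letters v"
  by (cases u; cases v) simp

lemma letters_0: "letters 0 = []"
  by (simp add: zero_word_def)

definition free_eval :: "('g \<Rightarrow> 'a::cq_algebra) \<Rightarrow> 'g free_alg \<Rightarrow> 'a" where
  "free_eval g x = (\<Sum>w\<in>Poly_Mapping.keys x. sc (Poly_Mapping.lookup x w) * prod_list (map g (letters w)))"

lemma free_eval_superset:
  assumes "finite A" "Poly_Mapping.keys x \<subseteq> A"
  shows "free_eval g x = (\<Sum>w\<in>A. sc (Poly_Mapping.lookup x w) * prod_list (map g (letters w)))"
  unfolding free_eval_def
  by (rule sum.mono_neutral_left) (use assms in \<open>auto simp: in_keys_iff\<close>)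

lemma free_eval_add: "free_eval g (x + y) = free_eval g x + free_eval g y"
proof -
  let ?A = "Poly_Mapping.keys x \<union> Poly_Mapping.keys y"
  show ?thesis
    using Poly_Mapping.keys_add[of x y]
    by (simp add: free_eval_superset[of ?A] lookup_add sc_add distrib_right sum.distrib)
qed

lemma free_eval_single:
  "free_eval g (Poly_Mapping.single w c) = sc c * prod_list (map g (letters w))"
  by (simp add: free_eval_def)

lemma free_eval_mult: "free_eval g (x * y) = free_eval g x * free_eval g y"
proof (induction x rule: update_induct)
  case const
  then show ?case by (simp add: free_eval_def)
next
  case (update x a b)
  have single: "free_eval g (Poly_Mapping.single a b * y)
      = free_eval g (Poly_Mapping.single a b) * free_eval g y"
  proof (induction y rule: update_induct)
    case const
    then show ?case by (simp add: free_eval_def)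
  next
    case (update y c d)
    \<comment> \<open>The key is new, so updating is adding a monomial and additivity reduces the
      claim to monomials.\<close>
    have *: "Poly_Mapping.update c d y = Poly_Mapping.single c d + y"
      using update by (intro poly_mapping_eqI)
        (auto simp: lookup_update lookup_add lookup_single in_keys_iff when_def)
    show ?case
      using update
      by (simp add: * distrib_left free_eval_add mult_single free_eval_single letters_plus
          sc_mult_sc_mult)
  qed
  have *: "Poly_Mapping.update a b x = Poly_Mapping.single a b + x"
    using update by (intro poly_mapping_eqI)
      (auto simp: lookup_update lookup_add lookup_single in_keys_iff when_def)
  show ?case
    using update by (simp add: * distrib_right free_eval_add single)
qed

lemma alg_hom_free_eval: "alg_hom (free_eval g)"
  by (simp add: alg_hom_def free_eval_add free_eval_mult scal_def free_eval_single letters_0)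

lemma free_eval_gen: "free_eval g (gen x) = g x"
  by (simp add: gen_def free_eval_single)

section \<open>Row determinants and the quantum exterior algebra\<close>

text \<open>Sign and power of \<open>q\<close> share one exponent: \<open>qp (-1)\<close> is the
  factor in the relation of the \<theta>'s, and \<open>qp (- int l)\<close> is the coefficient of a
  permutation of length \<open>l\<close> in the Berezinian.\<close>

definition qp :: "int \<Rightarrow> 'a::cq_algebra" where
  "qp e = sc ((- q) powi e)"

lemma qp_0 [simp]: "qp 0 = 1"
  by (simp add: qp_def)

lemma qp_add: "qp (a + b) = qp a * qp b"
  by (simp add: qp_def power_int_add flip: sc_mult)

lemma qp_left_commute: "x * (qp e * y) = qp e * (x * y)"
  by (simp add: qp_def sc_left_commute)

lemma qp_qp: "qp a * (qp b * x) = qp (a + b) * x"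
  by (simp add: qp_add mult.assoc)

lemma qp_cancel: "qp e * x = qp e * y \<Longrightarrow> x = y"
  unfolding qp_def by (erule sc_cancel[rotated]) simp

lemma sorted_list_of_set_insert_min:
  fixes b :: "'a::linorder"
  assumes "finite A" "\<forall>a\<in>A. b < a"
  shows "sorted_list_of_set (insert b A) = b # sorted_list_of_set A"
  using assms by (subst sorted_list_of_set_insert) (auto intro: insort_is_Cons simp: less_imp_le)

text \<open>A vector \<open>v\<close> stands for the element \<open>\<Sum>\<^sub>S v(S) \<theta>\<^sub>S\<close> of the exterior algebra in
  variables with \<open>\<theta>\<^sub>l \<theta>\<^sub>k = -q\<^sup>-\<^sup>1 \<theta>\<^sub>k \<theta>\<^sub>l\<close> for \<open>k < l\<close> that commute with the
  coefficients; \<open>wedge x\<close> is left multiplication by \<open>\<Sum>\<^sub>k x\<^sub>k \<theta>\<^sub>k\<close>.\<close>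

definition wedge :: "(nat \<Rightarrow> 'a::cq_algebra) \<Rightarrow> (nat set \<Rightarrow> 'a) \<Rightarrow> nat set \<Rightarrow> 'a" where
  "wedge x v S = (\<Sum>k\<in>S. qp (- int (card {s\<in>S. s < k})) * (x k * v (S - {k})))"

text \<open>The unit of the exterior algebra: with it, \<open>wedges X A vac\<close> is the ordered
  product of the linear forms given by the rows in \<open>A\<close>.\<close>

definition vac :: "nat set \<Rightarrow> 'a::cq_algebra" where
  "vac S = (if S = {} then 1 else 0)"

definition wedges :: "(nat \<Rightarrow> nat \<Rightarrow> 'a::cq_algebra) \<Rightarrow> nat set \<Rightarrow> (nat set \<Rightarrow> 'a) \<Rightarrow> nat set \<Rightarrow> 'a" where
  "wedges X A v = foldr (\<lambda>i. wedge (X i)) (sorted_list_of_set A) v"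

definition rdet :: "nat set \<Rightarrow> (nat \<Rightarrow> nat \<Rightarrow> 'a::cq_algebra) \<Rightarrow> 'a" where
  "rdet S X = wedges X S vac S"

lemma wedges_empty [simp]: "wedges X {} v = v"
  by (simp add: wedges_def)

lemma wedges_insert_min:
  "finite A \<Longrightarrow> \<forall>a\<in>A. b < a \<Longrightarrow> wedges X (insert b A) v = wedge (X b) (wedges X A v)"
  by (simp only: wedges_def sorted_list_of_set_insert_min foldr.simps comp_apply)

lemma wedge_cong:
  assumes "\<And>k. k \<in> S \<Longrightarrow> x k = y k" "\<And>T. T \<subseteq> S \<Longrightarrow> v T = w T"
  shows "wedge x v S = wedge y w S"
  unfolding wedge_def by (intro sum.cong refl) (simp add: assms)

lemma wedge_qp: "wedge x (\<lambda>T. qp e * v T) S = qp e * wedge x v S"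
  unfolding wedge_def sum_distrib_left
  by (intro sum.cong refl) (simp add: qp_left_commute[of "x _"] qp_qp add.commute)

lemma wedge_zero: "(\<And>T. T \<subseteq> S \<Longrightarrow> v T = 0) \<Longrightarrow> wedge x v S = 0"
  unfolding wedge_def by (intro sum.neutral ballI) simp

text \<open>The \<open>c j\<close> need not commute with the entries. They can be pulled out because
  they stand to the left in the outermost form.\<close>

lemma wedge_linear:
  assumes "\<And>k. k \<in> S \<Longrightarrow> x k = y k + (\<Sum>j\<in>J. c j * X j k)"
  shows "wedge x v S = wedge y v S + (\<Sum>j\<in>J. c j * wedge (X j) v S)"
proof -
  have "wedge x v S = (\<Sum>k\<in>S. qp (- int (card {s\<in>S. s < k})) * (y k * v (S - {k}))
      + (\<Sum>j\<in>J. c j * (qp (- int (card {s\<in>S. s < k})) * (X j k * v (S - {k})))))"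
    unfolding wedge_def
    by (intro sum.cong refl)
       (simp add: assms distrib_right distrib_left sum_distrib_right sum_distrib_left
         qp_left_commute[of "c _"] mult.assoc)
  also have "\<dots> = wedge y v S + (\<Sum>j\<in>J. c j * wedge (X j) v S)"
    unfolding sum.distrib wedge_def sum_distrib_left by (subst sum.swap[of _ J]) simp
  finally show ?thesis .
qed

text \<open>The pair \<open>k < l\<close> is removed in both orders. The bracket is the coefficient
  of \<theta>_k \<theta>_l in the product of the two forms, and the power in front moves this pair
  to its place in \<theta>_S.\<close>

lemma wedge_wedge:
  assumes fin: "finite S"
  shows "wedge x (wedge y v) S =
    (\<Sum>(k, l) | k \<in> S \<and> l \<in> S \<and> k < l.
       qp (1 - int (card {s\<in>S. s < k}) - int (card {s\<in>S. s < l}))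
         * ((x k * y l + qp (-1) * (x l * y k)) * v (S - {k, l})))"
proof -
  let ?c = "\<lambda>k. int (card {s\<in>S. s < k})"
  let ?t = "\<lambda>k l. qp (- ?c k) * (x k * (qp (- int (card {s\<in>S - {k}. s < l})) * (y l * v (S - {k} - {l}))))"
  let ?P = "{(k, l). k \<in> S \<and> l \<in> S \<and> k < l}" and ?Q = "{(k, l). k \<in> S \<and> l \<in> S \<and> l < k}"
  have P: "finite ?P" "finite ?Q"
    by (rule finite_subset[of _ "S \<times> S"]; use fin in auto)+
  have "wedge x (wedge y v) S = (\<Sum>k\<in>S. \<Sum>l\<in>S - {k}. ?t k l)"
    by (simp add: wedge_def sum_distrib_left)
  also have "\<dots> = (\<Sum>(k, l)\<in>Sigma S (\<lambda>k. S - {k}). ?t k l)"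
    by (rule sum.Sigma) (use fin in auto)
  also have "Sigma S (\<lambda>k. S - {k}) = ?P \<union> ?Q"
    by auto
  also have "(\<Sum>(k, l)\<in>?P \<union> ?Q. ?t k l) = (\<Sum>(k, l)\<in>?P. ?t k l) + (\<Sum>(k, l)\<in>?Q. ?t k l)"
    by (rule sum.union_disjoint) (use P in auto)
  also have "(\<Sum>(k, l)\<in>?Q. ?t k l) = (\<Sum>(k, l)\<in>?P. ?t l k)"
    by (rule sum.reindex_bij_witness[of _ "\<lambda>(a, b). (b, a)" "\<lambda>(a, b). (b, a)"]) auto
  also have "(\<Sum>(k, l)\<in>?P. ?t k l) + (\<Sum>(k, l)\<in>?P. ?t l k)
     = (\<Sum>(k, l)\<in>?P. ?t k l + ?t l k)"
    by (simp add: sum.distrib case_prod_unfold)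
  also have "\<dots> = (\<Sum>(k, l)\<in>?P. qp (1 - ?c k - ?c l)
         * ((x k * y l + qp (-1) * (x l * y k)) * v (S - {k, l})))"
  proof (intro sum.cong refl, clarify)
    fix k l assume kl: "k \<in> S" "l \<in> S" "k < l"
    \<comment> \<open>Deleting \<open>k\<close> lowers the number of elements below \<open>l\<close>
      by one, while deleting \<open>l\<close> leaves the number below \<open>k\<close> unchanged.
      This is the source of the 1 in the exponent.\<close>
    have "{s\<in>S. s < l} = insert k {s\<in>S - {k}. s < l}" using kl by auto
    then have 1: "int (card {s\<in>S - {k}. s < l}) = ?c l - 1"
      using fin by simp
    have 2: "{s\<in>S - {l}. s < k} = {s\<in>S. s < k}" using kl by auto
    have 3: "S - {k} - {l} = S - {k, l}" "S - {l} - {k} = S - {k, l}" by auto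
    have 4: "- ?c k + - (?c l - 1) = 1 - ?c k - ?c l" "- ?c l + - ?c k = (1 - ?c k - ?c l) + -1"
      by simp_all
    show "?t k l + ?t l k = qp (1 - ?c k - ?c l)
         * ((x k * y l + qp (-1) * (x l * y k)) * v (S - {k, l}))"
      unfolding 1 2 3 qp_left_commute[of "x _"] qp_qp 4
      by (simp only: distrib_left distrib_right mult.assoc qp_add)
  qed
  finally show ?thesis .
qed

text \<open>Coefficientwise, for the linear forms of the rows: each form squares to zero, and for
  \<open>i < j\<close> form \<open>j\<close> times form \<open>i\<close> is -1/q times form
  \<open>i\<close> times form \<open>j\<close>. The rows thus obey the same exchange rules as the
  \<theta>'s.\<close>

definition qrows :: "nat set \<Rightarrow> nat set \<Rightarrow> (nat \<Rightarrow> nat \<Rightarrow> 'a::cq_algebra) \<Rightarrow> bool" where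
  "qrows A K X \<longleftrightarrow>
     (\<forall>i\<in>A. \<forall>k\<in>K. \<forall>l\<in>K. k < l \<longrightarrow> X i k * X i l + qp (-1) * (X i l * X i k) = 0) \<and>
     (\<forall>i\<in>A. \<forall>j\<in>A. \<forall>k\<in>K. \<forall>l\<in>K. i < j \<longrightarrow> k < l \<longrightarrow>
        X j k * X i l + qp (-1) * (X j l * X i k)
        = qp (-1) * (X i k * X j l + qp (-1) * (X i l * X j k)))"

lemma qrows_mono: "qrows A K X \<Longrightarrow> A' \<subseteq> A \<Longrightarrow> K' \<subseteq> K \<Longrightarrow> qrows A' K' X"
  unfolding qrows_def by blast

lemma wedge_row_square:
  assumes "qrows A S X" "i \<in> A" "finite S"
  shows "wedge (X i) (wedge (X i) v) S = 0"
  unfolding wedge_wedge[OF assms(3)]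
  using assms(1,2) by (intro sum.neutral) (auto simp: qrows_def)

lemma wedge_row_swap:
  assumes "qrows A S X" "i \<in> A" "j \<in> A" "i < j" "finite S"
  shows "wedge (X j) (wedge (X i) v) S = qp (-1) * wedge (X i) (wedge (X j) v) S"
  unfolding wedge_wedge[OF assms(5)] sum_distrib_left
proof (intro sum.cong refl, clarify)
  fix k l assume "k \<in> S" "l \<in> S" "k < l"
  then have "X j k * X i l + qp (-1) * (X j l * X i k)
        = qp (-1) * (X i k * X j l + qp (-1) * (X i l * X j k))"
    using assms by (simp add: qrows_def)
  then show "qp (1 - int (card {s\<in>S. s < k}) - int (card {s\<in>S. s < l})) *
       ((X j k * X i l + qp (-1) * (X j l * X i k)) * v (S - {k, l})) =
       qp (-1) * (qp (1 - int (card {s\<in>S. s < k}) - int (card {s\<in>S. s < l})) *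
       ((X i k * X j l + qp (-1) * (X i l * X j k)) * v (S - {k, l})))"
    by (simp only: mult.assoc qp_qp add.commute)
qed

text \<open>The form of row \<open>j\<close> moves right past the rows below \<open>j\<close>, each
  giving a factor -1/q, until it reaches its place or meets itself and squares to zero.\<close>

lemma wedge_wedges:
  assumes "finite A" "qrows (insert j A) K X" "finite K" "S \<subseteq> K"
  shows "wedge (X j) (wedges X A v) S =
     (if j \<in> A then 0 else qp (- int (card {a\<in>A. a < j})) * wedges X (insert j A) v S)"
  using assms
proof (induction A arbitrary: S rule: finite_linorder_min_induct)
  case empty
  then show ?case by (simp add: wedges_insert_min[of "{}", simplified])
next
  case (insert b A)
  have finS: "finite S" using insert.prems finite_subset by blast
  have b: "wedges X (insert b A) v = wedge (X b) (wedges X A v)"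
    using insert.hyps by (simp add: wedges_insert_min)
  have rowsS: "qrows (insert j (insert b A)) S X"
    using insert.prems by (auto intro: qrows_mono)
  consider "j = b" | "j < b" | "b < j" by linarith
  then show ?case
  proof cases
    case 1
    then show ?thesis
      using wedge_row_square[OF rowsS _ finS] by (simp add: b)
  next
    case 2
    then have *: "\<forall>a\<in>insert b A. j < a" "{a \<in> insert b A. a < j} = {}" using insert.hyps by force+
    have "wedges X (insert j (insert b A)) v = wedge (X j) (wedges X (insert b A) v)"
      by (rule wedges_insert_min) (use insert.hyps * in auto)
    moreover have "j \<notin> insert b A" using * by auto
    ultimately show ?thesis by (simp only: *(2)) simp
  next
    case 3
    have IH: "wedge (X j) (wedges X A v) T =
     (if j \<in> A then 0 else qp (- int (card {a\<in>A. a < j})) * wedges X (insert j A) v T)"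
      if "T \<subseteq> S" for T
      using insert.prems that by (intro insert.IH) (auto intro: qrows_mono)
    have swap: "wedge (X j) (wedges X (insert b A) v) S
        = qp (-1) * wedge (X b) (wedge (X j) (wedges X A v)) S"
      unfolding b by (rule wedge_row_swap[OF rowsS]) (use 3 finS in auto)
    show ?thesis
    proof (cases "j \<in> A")
      case True
      have "wedge (X b) (wedge (X j) (wedges X A v)) S = 0"
        by (rule wedge_zero) (simp add: IH True)
      then show ?thesis using swap True by simp
    next
      case False
      have "wedge (X b) (wedge (X j) (wedges X A v)) S
          = wedge (X b) (\<lambda>T. qp (- int (card {a\<in>A. a < j})) * wedges X (insert j A) v T) S"
        by (rule wedge_cong) (use IH False in auto)
      also have "\<dots> = qp (- int (card {a\<in>A. a < j})) * wedges X (insert j (insert b A)) v S"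
        using insert.hyps 3 wedges_insert_min[of "insert j A" b X v]
        by (simp add: wedge_qp insert_commute)
      moreover have "{a \<in> insert b A. a < j} = insert b {a\<in>A. a < j}" using 3 by auto
      then have "card {a \<in> insert b A. a < j} = Suc (card {a\<in>A. a < j})"
        using insert.hyps by auto
      ultimately show ?thesis using swap False 3 by (simp add: qp_qp)
    qed
  qed
qed

text \<open>For disjoint sets, the number of inversions of the increasing list of \<open>A\<close>
  followed by that of \<open>B\<close>. It is used both for merging rows and for splitting
  columns.\<close>

definition crossings :: "nat set \<Rightarrow> nat set \<Rightarrow> nat" where
  "crossings A B = (\<Sum>a\<in>A. card {b\<in>B. b < a})"

lemma wedges_union:
  assumes "finite A" "finite B" "A \<inter> B = {}" "qrows (A \<union> B) K X" "finite K" "S \<subseteq> K"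
  shows "wedges X A (wedges X B v) S = qp (- int (crossings A B)) * wedges X (A \<union> B) v S"
  using assms
proof (induction A arbitrary: S rule: finite_linorder_min_induct)
  case empty
  then show ?case by (simp add: crossings_def)
next
  case (insert b A)
  have IH: "wedges X A (wedges X B v) T = qp (- int (crossings A B)) * wedges X (A \<union> B) v T"
    if "T \<subseteq> S" for T
    using insert.prems that by (intro insert.IH) (auto intro: qrows_mono)
  have bA: "b \<notin> A" using insert.hyps by auto
  have "wedges X (insert b A) (wedges X B v) S
      = wedge (X b) (\<lambda>T. qp (- int (crossings A B)) * wedges X (A \<union> B) v T) S"
    using insert.hyps IH by (auto simp: wedges_insert_min intro!: wedge_cong)
  also have "\<dots> = qp (- int (crossings A B)) * (qp (- int (card {a\<in>A \<union> B. a < b}))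
      * wedges X (insert b A \<union> B) v S)"
    unfolding wedge_qp using insert.hyps insert.prems bA
    by (subst wedge_wedges[where K = K]) auto
  also have "{a\<in>A \<union> B. a < b} = {a\<in>B. a < b}"
    using insert.hyps by auto
  finally show ?case
    using insert.hyps bA by (simp add: qp_qp crossings_def add.commute)
qed

section \<open>Row elimination and block factorization\<close>

lemma wedge_wedges_absorb:
  assumes "finite A" "finite B" "A \<inter> B = {}" "qrows (A \<union> B) K X" "finite K" "S \<subseteq> K" "j \<in> B"
  shows "wedge (X j) (wedges X A (wedges X B v)) S = 0"
proof -
  have "wedge (X j) (wedges X A (wedges X B v)) S
      = wedge (X j) (\<lambda>T. qp (- int (crossings A B)) * wedges X (A \<union> B) v T) S"
    by (rule wedge_cong, simp) (rule wedges_union[where K = K], use assms in auto)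
  also have "\<dots> = 0"
    unfolding wedge_qp using assms
    by (subst wedge_wedges[where K = K]) (auto simp: insert_absorb)
  finally show ?thesis .
qed

text \<open>Adding a left multiple of a row in \<open>B\<close> to a row in \<open>A\<close> changes
  nothing, because the product already contains that row of \<open>B\<close> and a repeated row
  gives zero.\<close>

lemma wedges_row_reduce:
  assumes "finite A" "finite B" "A \<inter> B = {}" "qrows (A \<union> B) K X" "finite K" "S \<subseteq> K"
    and red: "\<And>a k. a \<in> A \<Longrightarrow> k \<in> K \<Longrightarrow> X a k = Y a k + (\<Sum>j\<in>B. c a j * X j k)"
  shows "wedges X A (wedges X B v) S = wedges Y A (wedges X B v) S"
  using assms
proof (induction A arbitrary: S rule: finite_linorder_min_induct)
  case empty
  then show ?case by simp
next
  case (insert b A)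
  have IH: "wedges X A (wedges X B v) T = wedges Y A (wedges X B v) T" if "T \<subseteq> S" for T
    using insert.prems that by (intro insert.IH) (auto intro: qrows_mono)
  have "wedges X (insert b A) (wedges X B v) S = wedge (X b) (wedges X A (wedges X B v)) S"
    using insert.hyps by (simp add: wedges_insert_min)
  \<comment> \<open>Exchange rules are available for the rows of \<open>X\<close> only, so row
    \<open>b\<close> is reduced while the rows behind it are still those of \<open>X\<close>; these
    are replaced afterwards.\<close>
  also have "\<dots> = wedge (Y b) (wedges X A (wedges X B v)) S
      + (\<Sum>j\<in>B. c b j * wedge (X j) (wedges X A (wedges X B v)) S)"
    by (rule wedge_linear) (use insert.prems in auto)
  also have "(\<Sum>j\<in>B. c b j * wedge (X j) (wedges X A (wedges X B v)) S) = 0"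
  proof (intro sum.neutral ballI)
    fix j assume j: "j \<in> B"
    have "wedge (X j) (wedges X A (wedges X B v)) S = 0"
      by (rule wedge_wedges_absorb[where K = K])
         (use insert.hyps insert.prems j in \<open>auto intro: qrows_mono\<close>)
    then show "c b j * wedge (X j) (wedges X A (wedges X B v)) S = 0" by simp
  qed
  also have "wedge (Y b) (wedges X A (wedges X B v)) S = wedge (Y b) (wedges Y A (wedges X B v)) S"
    by (rule wedge_cong) (use IH in auto)
  also have "\<dots> = wedges Y (insert b A) (wedges X B v) S"
    using insert.hyps by (simp add: wedges_insert_min)
  finally show ?case by simp
qed

text \<open>As many rows as there are columns in \<open>A\<close>, all vanishing on
  \<open>B\<close>, must use up exactly the columns in \<open>A\<close>, which leaves
  \<open>v B\<close>. The power of -q moves those columns in front of \<open>B\<close>. The rows are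
  an arbitrary list because reduced rows obey no exchange rules.\<close>

lemma foldr_wedge_split:
  assumes "finite A" "finite B" "A \<inter> B = {}" "length is = card A"
    and "\<And>i k. i \<in> set is \<Longrightarrow> k \<in> B \<Longrightarrow> Y i k = 0"
  shows "foldr (\<lambda>i. wedge (Y i)) is v (A \<union> B)
    = qp (- int (crossings A B)) * (foldr (\<lambda>i. wedge (Y i)) is vac A * v B)"
  using assms
proof (induction "is" arbitrary: A)
  case Nil
  then show ?case by (simp add: crossings_def vac_def)
next
  case (Cons i "is")
  let ?F = "\<lambda>v. foldr (\<lambda>i. wedge (Y i)) is v"
  let ?c = "\<lambda>S k. int (card {s\<in>S. s < k})"
  have "wedge (Y i) (?F v) (A \<union> B)
      = (\<Sum>k\<in>A. qp (- ?c (A \<union> B) k) * (Y i k * ?F v (A \<union> B - {k})))"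
    unfolding wedge_def
    by (rule sum.mono_neutral_right) (use Cons.prems in auto)
  also have "\<dots> = (\<Sum>k\<in>A. qp (- int (crossings A B)) *
      (qp (- ?c A k) * (Y i k * ?F vac (A - {k})) * v B))"
  proof (intro sum.cong refl)
    fix k assume k: "k \<in> A"
    have "A \<union> B - {k} = (A - {k}) \<union> B" using k Cons.prems by auto
    moreover have "?F v ((A - {k}) \<union> B) = qp (- int (crossings (A - {k}) B)) * (?F vac (A - {k}) * v B)"
      using Cons.prems k by (intro Cons.IH) auto
    moreover have "crossings A B = card {s\<in>B. s < k} + crossings (A - {k}) B"
      unfolding crossings_def using k Cons.prems by (simp add: sum.remove)
    moreover have "{s\<in>A \<union> B. s < k} = {s\<in>A. s < k} \<union> {s\<in>B. s < k}" by auto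
    then have "card {s\<in>A \<union> B. s < k} = card {s\<in>A. s < k} + card {s\<in>B. s < k}"
      using Cons.prems by (auto intro!: card_Un_disjoint)
    ultimately show "qp (- ?c (A \<union> B) k) * (Y i k * ?F v (A \<union> B - {k})) = qp (- int (crossings A B)) *
      (qp (- ?c A k) * (Y i k * ?F vac (A - {k})) * v B)"
      by (simp add: mult.assoc qp_left_commute[of "Y _ _"] qp_qp algebra_simps)
  qed
  also have "\<dots> = qp (- int (crossings A B)) * (wedge (Y i) (?F vac) A * v B)"
    by (simp add: wedge_def sum_distrib_left sum_distrib_right)
  finally show ?case by simp
qed

text \<open>Clearing the columns \<open>B\<close> from the rows \<open>A\<close> leaves
  \<open>Y\<close>. Rows and columns are split in the same way, so merging the rows and splitting
  the columns produce the same power of -q, which cancels.\<close>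

theorem rdet_schur:
  assumes "finite A" "finite B" "A \<inter> B = {}" "qrows (A \<union> B) (A \<union> B) X"
    and col_B: "\<And>a k. a \<in> A \<Longrightarrow> k \<in> B \<Longrightarrow> X a k = (\<Sum>j\<in>B. c a j * X j k)"
    and col_A: "\<And>a k. a \<in> A \<Longrightarrow> k \<in> A \<Longrightarrow> X a k = Y a k + (\<Sum>j\<in>B. c a j * X j k)"
  shows "rdet (A \<union> B) X = rdet A Y * rdet B X"
proof -
  \<comment> \<open>The columns in \<open>B\<close> have been cleared; \<open>Y\<close> is
    prescribed only on columns in \<open>A\<close>.\<close>
  define Z where "Z = (\<lambda>a k. if k \<in> B then 0 else Y a k)"
  have "qp (- int (crossings A B)) * rdet (A \<union> B) X = wedges X A (wedges X B vac) (A \<union> B)"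
    unfolding rdet_def by (rule wedges_union[symmetric, where K = "A \<union> B"]) (use assms in auto)
  also have "\<dots> = wedges Z A (wedges X B vac) (A \<union> B)"
    by (rule wedges_row_reduce[where K = "A \<union> B" and c = c])
       (use assms in \<open>auto simp: Z_def\<close>)
  also have "\<dots> = qp (- int (crossings A B)) * (wedges Z A vac A * wedges X B vac B)"
    unfolding wedges_def[of Z] by (rule foldr_wedge_split) (use assms in \<open>auto simp: Z_def\<close>)
  also have "wedges Z A vac A = rdet A Y"
  proof -
    have "foldr (\<lambda>i. wedge (Z i)) is vac S = foldr (\<lambda>i. wedge (Y i)) is vac S"
      if "S \<subseteq> A" for "is" S
      using that
    proof (induction "is" arbitrary: S)
      case (Cons i "is")
      show ?case
        unfolding foldr.simps comp_apply
        by (rule wedge_cong) (use Cons.prems assms(3) Cons.IH in \<open>auto simp: Z_def\<close>)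
    qed simp
    then show ?thesis by (simp add: rdet_def wedges_def)
  qed
  finally show ?thesis
    unfolding rdet_def by (rule qp_cancel)
qed

lemma rdet_empty [simp]: "rdet {} X = 1"
  by (simp add: rdet_def vac_def)

section \<open>Expansion of row determinants over permutations\<close>

fun linv :: "nat list \<Rightarrow> nat" where
  "linv [] = 0"
| "linv (k # ks) = card {s\<in>set ks. s < k} + linv ks"

text \<open>Expansion along the first row: choosing column \<open>k\<close> costs the number of
  remaining columns below \<open>k\<close>, which is the first summand of
  \<open>linv\<close>.\<close>

lemma foldr_wedge_vac:
  assumes "finite S" "length is = card S"
  shows "foldr (\<lambda>i. wedge (X i)) is vac S =
    (\<Sum>ks\<in>permutations_of_set S. qp (- int (linv ks)) * prod_list (map2 X is ks))"
  using assms
proof (induction "is" arbitrary: S)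
  case Nil
  then show ?case by (simp add: vac_def)
next
  case (Cons i "is")
  have ne: "S \<noteq> {}" using Cons.prems by auto
  have "(\<Sum>ks\<in>permutations_of_set S. qp (- int (linv ks)) * prod_list (map2 X (i # is) ks))
    = (\<Sum>k\<in>S. \<Sum>ks\<in>(#) k ` permutations_of_set (S - {k}).
         qp (- int (linv ks)) * prod_list (map2 X (i # is) ks))"
    unfolding permutations_of_set_nonempty[OF ne]
    by (rule sum.UNION_disjoint) (use Cons.prems in auto)
  also have "\<dots> = wedge (X i) (foldr (\<lambda>i. wedge (X i)) is vac) S"
    unfolding wedge_def[of _ "foldr _ _ _"]
  proof (rule sum.cong[OF refl])
    fix k assume k: "k \<in> S"
    have "(\<Sum>ks\<in>(#) k ` permutations_of_set (S - {k}).
         qp (- int (linv ks)) * prod_list (map2 X (i # is) ks))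
      = (\<Sum>ks\<in>permutations_of_set (S - {k}).
         qp (- int (linv (k # ks))) * prod_list (map2 X (i # is) (k # ks)))"
      by (subst sum.reindex) auto
    also have "\<dots> = (\<Sum>ks\<in>permutations_of_set (S - {k}).
         qp (- int (card {s\<in>S. s < k})) * (X i k * (qp (- int (linv ks)) * prod_list (map2 X is ks))))"
    proof (intro sum.cong refl)
      fix ks assume "ks \<in> permutations_of_set (S - {k})"
      then have "{s\<in>set ks. s < k} = {s\<in>S. s < k}"
        by (auto dest: permutations_of_setD)
      then show "qp (- int (linv (k # ks))) * prod_list (map2 X (i # is) (k # ks))
        = qp (- int (card {s\<in>S. s < k})) * (X i k * (qp (- int (linv ks)) * prod_list (map2 X is ks)))"
        by (simp add: qp_left_commute[of "X _ _"] qp_qp)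
    qed
    also have "\<dots> = qp (- int (card {s\<in>S. s < k})) * (X i k * foldr (\<lambda>i. wedge (X i)) is vac (S - {k}))"
      using Cons.prems k by (subst Cons.IH) (auto simp: sum_distrib_left)
    finally show "(\<Sum>ks\<in>(#) k ` permutations_of_set (S - {k}).
         qp (- int (linv ks)) * prod_list (map2 X (i # is) ks))
      = qp (- int (card {s\<in>S. s < k})) * (X i k * foldr (\<lambda>i. wedge (X i)) is vac (S - {k}))" .
  qed
  finally show ?case by simp
qed

lemma rdet_permutations:
  "finite S \<Longrightarrow> rdet S X = (\<Sum>ks\<in>permutations_of_set S.
     qp (- int (linv ks)) * prod_list (map2 X (sorted_list_of_set S) ks))"
  by (simp add: rdet_def wedges_def foldr_wedge_vac)

lemma sum_single: "(\<Sum>k\<in>{b}. t k) = t b"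
  by simp

text \<open>The first row can only use the smallest column, so no power of -q arises. This makes
  determinants of blocks of shifts visibly invertible.\<close>

lemma rdet_diagonal:
  assumes "finite S" "\<And>i j. i \<in> S \<Longrightarrow> j \<in> S \<Longrightarrow> i \<noteq> j \<Longrightarrow> X i j = 0"
  shows "rdet S X = prod_list (map (\<lambda>i. X i i) (sorted_list_of_set S))"
  using assms
proof (induction S rule: finite_linorder_min_induct)
  case (insert b A)
  have b: "b \<notin> A" using insert.hyps by auto
  have "rdet (insert b A) X = wedge (X b) (wedges X A vac) (insert b A)"
    using insert.hyps by (simp add: rdet_def wedges_insert_min)
  also have "\<dots> = (\<Sum>k\<in>{b}. qp (- int (card {s\<in>insert b A. s < k}))
      * (X b k * wedges X A vac (insert b A - {k})))"
    unfolding wedge_def by (rule sum.mono_neutral_right) (use insert b in auto)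
  moreover have none: "{s\<in>insert b A. s < b} = {}"
    using insert.hyps by auto
  have "(\<Sum>k\<in>{b}. qp (- int (card {s\<in>insert b A. s < k}))
      * (X b k * wedges X A vac (insert b A - {k}))) = X b b * rdet A X"
    unfolding sum_single none
    using b by (simp add: rdet_def)
  ultimately show ?case
    using insert by (simp add: sorted_list_of_set_insert_min del: sorted_list_of_set_insert_remove)
qed simp

section \<open>Quantum super Manin matrices on index sets\<close>

definition el :: "nat set \<Rightarrow> nat \<Rightarrow> nat" where
  "el K a = sorted_list_of_set K ! (a - 1)"

definition pos :: "nat set \<Rightarrow> nat \<Rightarrow> nat" where
  "pos K i = (THE a. a \<in> {1..card K} \<and> el K a = i)"

lemma el_less:
  assumes "a \<in> {1..card K}" "b \<in> {1..card K}"
  shows "el K a < el K b \<longleftrightarrow> a < b"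
proof -
  have *: "el K a < el K b" if "a < b" "a \<in> {1..card K}" "b \<in> {1..card K}" for a b
    unfolding el_def using that
    by (intro sorted_wrt_nth_less[OF strict_sorted_list_of_set]) auto
  show ?thesis
    using *[of a b] *[of b a] assms by (cases a b rule: linorder_cases) auto
qed

lemma bij_betw_el: "finite K \<Longrightarrow> bij_betw (el K) {1..card K} K"
proof -
  assume fin: "finite K"
  have "inj_on (el K) {1..card K}"
    by (rule inj_onI) (metis el_less less_irrefl linorder_neqE)
  moreover have "el K ` {1..card K} = K"
  proof -
    have "el K ` {1..card K} = (\<lambda>a. sorted_list_of_set K ! a) ` {..<card K}"
      unfolding el_def
      by (force simp: image_iff intro: bexI[of _ "Suc _"])
    also have "\<dots> = K"
      using fin set_sorted_list_of_set[OF fin] by (auto simp: set_conv_nth)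
    finally show ?thesis .
  qed
  ultimately show ?thesis by (simp add: bij_betw_def)
qed

lemma el_in: "finite K \<Longrightarrow> a \<in> {1..card K} \<Longrightarrow> el K a \<in> K"
  using bij_betw_el by (blast dest: bij_betwE)

lemma el_eq_iff:
  "a \<in> {1..card K} \<Longrightarrow> b \<in> {1..card K} \<Longrightarrow> el K a = el K b \<longleftrightarrow> a = b"
  by (metis el_less less_irrefl linorder_neqE)

lemma pos_el: "a \<in> {1..card K} \<Longrightarrow> pos K (el K a) = a"
  unfolding pos_def by (rule the_equality) (use el_eq_iff[of _ K a] in auto)

lemma ball_el: "finite K \<Longrightarrow> (\<forall>i\<in>K. P i) \<longleftrightarrow> (\<forall>a\<in>{1..card K}. P (el K a))"
  by (simp only: ball_simps(9)[symmetric] bij_betw_imp_surj_on[OF bij_betw_el])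

lemma sum_el: "finite K \<Longrightarrow> (\<Sum>i\<in>K. g i) = (\<Sum>a\<in>{1..card K}. g (el K a))"
  by (rule sum.reindex_bij_betw[OF bij_betw_el, symmetric])

lemma eps_el:
  "a \<in> {1..card K} \<Longrightarrow> b \<in> {1..card K} \<Longrightarrow> eps (el K a) (el K b) = eps a b"
  using el_less[of a K b] el_less[of b K a]
  by (cases a b rule: linorder_cases) (auto simp: eps_def)

lemma sorted_list_of_set_split:
  fixes K :: "nat set"
  assumes "finite K" "0 \<notin> K"
  shows "sorted_list_of_set K = sorted_list_of_set (K \<inter> {1..m}) @ sorted_list_of_set (K - {1..m})"
proof -
  have "sorted_list_of_set (K \<inter> {1..m} \<union> (K - {1..m}))
      = sorted_list_of_set (K \<inter> {1..m}) @ sorted_list_of_set (K - {1..m})"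
  proof (rule sorted_distinct_set_unique)
    have "x \<le> y" if "x \<in> K \<inter> {1..m}" "y \<in> K - {1..m}" for x y
    proof -
      have "y \<noteq> 0" using assms that by (metis DiffD1)
      then show ?thesis using that by auto
    qed
    then show "sorted (sorted_list_of_set (K \<inter> {1..m}) @ sorted_list_of_set (K - {1..m}))"
      using assms by (auto simp: sorted_append)
  qed (use assms in auto)
  moreover have "K \<inter> {1..m} \<union> (K - {1..m}) = K" by auto
  ultimately show ?thesis by simp
qed

lemma num_even_odd: "finite K \<Longrightarrow> num_even m K + num_odd m K = card K"
  unfolding num_even_def num_odd_def using card_Int_Diff[of K "{1..m}"] by simp

lemma el_even:
  assumes "finite K" "0 \<notin> K" "a \<in> {1..num_even m K}"
  shows "el K a = el (K \<inter> {1..m}) a"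
  unfolding el_def using assms
  by (subst sorted_list_of_set_split[where m = m]) (auto simp: nth_append num_even_def)

lemma el_odd:
  assumes "finite K" "0 \<notin> K" "a \<ge> 1"
  shows "el K (num_even m K + a) = el (K - {1..m}) a"
  unfolding el_def using assms
  by (subst sorted_list_of_set_split[where m = m]) (auto simp: nth_append num_even_def)

text \<open>Even elements precede odd ones. The index 0 is excluded since \<open>par m 0 = 0\<close>
  although \<open>num_even\<close> counts only elements of \<open>{1..m}\<close>.\<close>

lemma par_el:
  assumes "finite K" "0 \<notin> K" "a \<in> {1..card K}"
  shows "par m (el K a) = par (num_even m K) a"
proof (cases "a \<le> num_even m K")
  case True
  then have "el (K \<inter> {1..m}) a \<in> K \<inter> {1..m}"
    using assms by (intro el_in) (auto simp: num_even_def)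
  then show ?thesis using True assms el_even[of K a m] by (auto simp: par_def)
next
  case False
  then obtain b where b: "a = num_even m K + b" "b \<ge> 1"
    using le_Suc_ex by (metis One_nat_def add_Suc_right less_iff_Suc_add not_le_imp_less le_add1 plus_1_eq_Suc)
  then have "el (K - {1..m}) b \<in> K - {1..m}"
    using assms num_even_odd[of K m] by (intro el_in) (auto simp: num_odd_def)
  moreover have "el (K - {1..m}) b \<noteq> 0" using calculation assms by (metis DiffD1)
  ultimately show ?thesis using False assms el_odd[of K b m] b by (auto simp: par_def)
qed

text \<open>The relations are indexed by the elements of \<open>K\<close> with their original order
  and parity, not by positions in \<open>K\<close>. They then restrict to subsets without
  renumbering, and they make sense in every algebra of the class.\<close>

definition manin_on :: "nat \<Rightarrow> nat set \<Rightarrow> Cq \<Rightarrow> 'a::cq_algebra mat \<Rightarrow> bool" where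
  "manin_on m K h A \<longleftrightarrow>
     (\<forall>i\<in>K. \<forall>j\<in>K. par m i = 1 \<longrightarrow> par m j = 0 \<longrightarrow> A i j * A i j = 0)
   \<and> (\<forall>i\<in>K. \<forall>k\<in>K. \<forall>l\<in>K. par m i = 1 \<longrightarrow> A i k * A i l
        = sc (h powi eps l k * (-1) ^ ((par m k + 1) * (par m l + 1))) * (A i l * A i k))
   \<and> (\<forall>i\<in>K. \<forall>j\<in>K. \<forall>k\<in>K. par m k = 0 \<longrightarrow> A i k * A j k
        = sc (h powi eps i j * (-1) ^ (par m i * par m j)) * (A j k * A i k))
   \<and> (\<forall>i\<in>K. \<forall>j\<in>K. \<forall>k\<in>K. \<forall>l\<in>K. A i j * A k l
        - sc (h powi (eps i k + eps l j)
                * (-1) ^ ((par m i + par m j) * (par m k + par m l))) * (A k l * A i j)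
      = sc (h powi eps i k
                * (-1) ^ (par m i * par m k + par m j * par m k + par m i * par m j))
           * (A k j * A i l)
        - sc (h powi eps l j
                * (-1) ^ (par m j * par m k + par m j * par m l + par m k * par m l))
           * (A i l * A k j))"

definition inv_on :: "nat set \<Rightarrow> 'a::ring_1 mat \<Rightarrow> 'a mat \<Rightarrow> bool" where
  "inv_on K A B \<longleftrightarrow> (\<forall>i\<in>K. \<forall>j\<in>K.
     (\<Sum>k\<in>K. A i k * B k j) = (if i = j then 1 else 0) \<and>
     (\<Sum>k\<in>K. B i k * A k j) = (if i = j then 1 else 0))"

definition st :: "nat \<Rightarrow> 'a::ring_1 mat \<Rightarrow> 'a mat" where
  "st m A = (\<lambda>i j. (-1) ^ (par m i * (par m i + par m j)) * A j i)"

definition tilde_on :: "nat \<Rightarrow> nat set \<Rightarrow> Cq \<Rightarrow> 'a::cq_algebra mat \<Rightarrow> 'a mat \<Rightarrow> bool" where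
  "tilde_on m K h A B \<longleftrightarrow> manin_on m K h A \<and> manin_on m K (inverse h) B
     \<and> inv_on K A B \<and> inv_on K (st m A) (st m B)"

section \<open>Passage from positions in a submatrix to the original indices\<close>

context
  fixes f :: "'g free_alg \<Rightarrow> 'a::cq_algebra" and K :: "nat set" and m :: nat
  assumes f: "alg_hom f" and K: "finite K" "0 \<notin> K"
begin

lemma manin_rels_iff:
  assumes A: "\<And>a b. a \<in> {1..card K} \<Longrightarrow> b \<in> {1..card K} \<Longrightarrow> f (A0 a b) = A (el K a) (el K b)"
  shows "(\<forall>x \<in> manin_rels (num_even m K) (num_odd m K) h A0. f x = 0) \<longleftrightarrow> manin_on m K h A"
proof -
  let ?N = "{1..card K}" and ?p = "par (num_even m K)"
  have "manin_on m K h A \<longleftrightarrow>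
     (\<forall>i\<in>?N. \<forall>j\<in>?N. ?p i = 1 \<longrightarrow> ?p j = 0 \<longrightarrow> f (A0 i j * A0 i j) = 0)
   \<and> (\<forall>i\<in>?N. \<forall>k\<in>?N. \<forall>l\<in>?N. ?p i = 1 \<longrightarrow> f (A0 i k * A0 i l
        - scal (h powi eps l k * (-1) ^ ((?p k + 1) * (?p l + 1))) * (A0 i l * A0 i k)) = 0)
   \<and> (\<forall>i\<in>?N. \<forall>j\<in>?N. \<forall>k\<in>?N. ?p k = 0 \<longrightarrow> f (A0 i k * A0 j k
        - scal (h powi eps i j * (-1) ^ (?p i * ?p j)) * (A0 j k * A0 i k)) = 0)
   \<and> (\<forall>i\<in>?N. \<forall>j\<in>?N. \<forall>k\<in>?N. \<forall>l\<in>?N. f ((A0 i j * A0 k l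
        - scal (h powi (eps i k + eps l j)
                * (-1) ^ ((?p i + ?p j) * (?p k + ?p l))) * (A0 k l * A0 i j))
      - (scal (h powi eps i k
                * (-1) ^ (?p i * ?p k + ?p j * ?p k + ?p i * ?p j))
           * (A0 k j * A0 i l)
        - scal (h powi eps l j
                * (-1) ^ (?p j * ?p k + ?p j * ?p l + ?p k * ?p l))
           * (A0 i l * A0 k j))) = 0)"
    unfolding manin_on_def ball_el[OF K(1)]
    by (simp only: alg_hom_diff[OF f] alg_hom_mult[OF f] alg_hom_scal[OF f] A par_el[OF K] eps_el
        right_minus_eq cong: ball_cong)
  also have "\<dots> \<longleftrightarrow> (\<forall>x \<in> manin_rels (num_even m K) (num_odd m K) h A0. f x = 0)"
    unfolding manin_rels_def num_even_odd[OF K(1)] by blast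
  finally show ?thesis by blast
qed

lemma inverse_rels_iff:
  assumes A: "\<And>a b. a \<in> {1..card K} \<Longrightarrow> b \<in> {1..card K} \<Longrightarrow> f (A0 a b) = A (el K a) (el K b)"
    and B: "\<And>a b. a \<in> {1..card K} \<Longrightarrow> b \<in> {1..card K} \<Longrightarrow> f (B0 a b) = B (el K a) (el K b)"
  shows "(\<forall>x \<in> inverse_rels (card K) A0 B0. f x = 0) \<longleftrightarrow> inv_on K A B"
proof -
  let ?N = "{1..card K}"
  have if_f: "f (if b then 1 else 0) = (if b then 1 else 0)" for b
    by (simp add: alg_hom_0[OF f] alg_hom_1[OF f])
  have "inv_on K A B \<longleftrightarrow> (\<forall>i\<in>?N. \<forall>j\<in>?N.
      f ((\<Sum>k=1..card K. A0 i k * B0 k j) - (if i = j then 1 else 0)) = 0 \<and>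
      f ((\<Sum>k=1..card K. B0 i k * A0 k j) - (if i = j then 1 else 0)) = 0)"
    unfolding inv_on_def ball_el[OF K(1)] sum_el[OF K(1)]
    by (simp only: alg_hom_diff[OF f] alg_hom_sum[OF f] alg_hom_mult[OF f] A B if_f el_eq_iff
        right_minus_eq cong: ball_cong sum.cong)
  also have "\<dots> \<longleftrightarrow> (\<forall>x \<in> inverse_rels (card K) A0 B0. f x = 0)"
    unfolding inverse_rels_def by blast
  finally show ?thesis by blast
qed

text \<open>Renumbering preserves order and parity, hence every sign and power in the relations. One
  direction extracts relations from a given homomorphism; the other checks that a newly built
  homomorphism kills the relations.\<close>

lemma tilde_rels_iff:
  assumes A: "\<And>a b. a \<in> {1..card K} \<Longrightarrow> b \<in> {1..card K} \<Longrightarrow> f (A0 a b) = A (el K a) (el K b)"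
    and B: "\<And>a b. a \<in> {1..card K} \<Longrightarrow> b \<in> {1..card K} \<Longrightarrow> f (B0 a b) = B (el K a) (el K b)"
  shows "(\<forall>x \<in> tilde_rels (num_even m K) (num_odd m K) h A0 B0. f x = 0) \<longleftrightarrow> tilde_on m K h A B"
proof -
  have transpose: "f (supertranspose (num_even m K) C0 a b) = st m C (el K a) (el K b)"
    if "a \<in> {1..card K}" "b \<in> {1..card K}"
      "\<And>a b. a \<in> {1..card K} \<Longrightarrow> b \<in> {1..card K} \<Longrightarrow> f (C0 a b) = C (el K a) (el K b)"
    for C0 C a b
    using that
    by (simp add: supertranspose_def st_def alg_hom_mult[OF f] alg_hom_power[OF f]
        alg_hom_minus[OF f] alg_hom_1[OF f] par_el[OF K])
  show ?thesis
    unfolding tilde_rels_def tilde_on_def num_even_odd[OF K(1)] ball_Un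
    using manin_rels_iff[of A0 A, OF A] manin_rels_iff[of B0 B, OF B]
      inverse_rels_iff[of A0 A B0 B, OF A B] inverse_rels_iff[of "supertranspose (num_even m K) A0" "st m A"
        "supertranspose (num_even m K) B0" "st m B"] transpose A B
    by simp
qed

end

lemma linv_conv_card:
  "distinct xs \<Longrightarrow> linv xs = card {(i, j). i < j \<and> j < length xs \<and> xs ! j < xs ! i}"
proof (induction xs)
  case (Cons k ks)
  let ?P = "{(i, j). i < j \<and> j < length ks \<and> ks ! j < ks ! i}"
  let ?J = "{j. j < length ks \<and> ks ! j < k}"
  let ?h = "\<lambda>(i, j). (Suc i, Suc j)"
  have "{(i, j). i < j \<and> j < length (k # ks) \<and> (k # ks) ! j < (k # ks) ! i}
      = (\<lambda>j. (0, Suc j)) ` ?J \<union> ?h ` ?P" (is "?L = ?R")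
  proof (rule set_eqI)
    fix p :: "nat \<times> nat"
    obtain i j where p: "p = (i, j)" by fastforce
    show "p \<in> ?L \<longleftrightarrow> p \<in> ?R"
      unfolding p by (cases i; cases j) auto
  qed
  moreover have "finite ?P" by (rule finite_subset[of _ "{..<length ks} \<times> {..<length ks}"]) auto
  ultimately have "card {(i, j). i < j \<and> j < length (k # ks) \<and> (k # ks) ! j < (k # ks) ! i}
      = card ((\<lambda>j. (0::nat, Suc j)) ` ?J) + card (?h ` ?P)"
    by (simp only:) (rule card_Un_disjoint, auto)
  also have "card (?h ` ?P) = card ?P"
    by (rule card_image) (auto simp: inj_on_def)
  also have "card ((\<lambda>j. (0::nat, Suc j)) ` ?J) = card ?J"
    by (rule card_image) (auto simp: inj_on_def)
  also have "card ?J = card ((\<lambda>j. ks ! j) ` ?J)"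
    using Cons.prems by (intro card_image[symmetric]) (auto simp: inj_on_def nth_eq_iff_index_eq)
  also have "(\<lambda>j. ks ! j) ` ?J = {s\<in>set ks. s < k}"
    by (auto simp: in_set_conv_nth)
  finally show ?case using Cons by simp
qed simp

text \<open>Identifies each sum in the definition of the Berezinian with a row determinant: a
  permutation \<open>\<rho>\<close> corresponds to the list of columns
  \<open>el S (\<rho> i)\<close>, with the same inversions because \<open>el S\<close> is
  increasing.\<close>

lemma rdet_permutes:
  assumes "finite S"
  shows "(\<Sum>\<rho> | \<rho> permutes {1..card S}. sc ((- q) powi (- int (inversions (card S) \<rho>)))
      * (\<Prod>i\<leftarrow>[1..<Suc (card S)]. X (el S i) (el S (\<rho> i)))) = rdet S X"
proof -
  let ?s = "card S"
  let ?F = "\<lambda>\<rho>. map (\<lambda>i. el S (\<rho> i)) [1..<Suc ?s]"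
  have maps: "\<rho> i \<in> {1..?s}" if "\<rho> permutes {1..?s}" "i \<in> {1..?s}" for \<rho> i
    using that permutes_in_image by metis
  have dist: "distinct (?F \<rho>)" and set_F: "set (?F \<rho>) = S" if "\<rho> permutes {1..?s}" for \<rho>
  proof -
    have "bij_betw (el S \<circ> \<rho>) {1..?s} S"
      using that assms by (intro bij_betw_trans[OF permutes_imp_bij bij_betw_el])
    then show "distinct (?F \<rho>)" "set (?F \<rho>) = S"
      by (auto simp: distinct_map bij_betw_def comp_def atLeastLessThanSuc_atLeastAtMost simp del: upt_Suc)
  qed
  have inj: "inj_on ?F {\<rho>. \<rho> permutes {1..?s}}"
  proof (rule inj_onI, clarsimp simp del: upt_Suc)
    fix \<rho> \<tau> assume *: "\<rho> permutes {Suc 0..?s}" "\<tau> permutes {Suc 0..?s}"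
      "\<forall>i\<in>{Suc 0..<Suc ?s}. el S (\<rho> i) = el S (\<tau> i)"
    have "\<rho> i = \<tau> i" if "i \<in> {1..?s}" for i
    proof -
      have "\<rho> i \<in> {1..?s}" "\<tau> i \<in> {1..?s}"
        using maps[of \<rho> i] maps[of \<tau> i] * that by auto
      moreover have "el S (\<rho> i) = el S (\<tau> i)"
        using * that by auto
      ultimately show ?thesis by (simp only: el_eq_iff)
    qed
    moreover have "\<rho> i = \<tau> i" if "i \<notin> {1..?s}" for i
      using * that by (simp add: permutes_not_in)
    ultimately show "\<rho> = \<tau>" by blast
  qed
  \<comment> \<open>An injection between finite sets with \<open>card S\<close> factorial elements
    each.\<close>
  have bij: "bij_betw ?F {\<rho>. \<rho> permutes {1..?s}} (permutations_of_set S)"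
  proof (unfold bij_betw_def, intro conjI inj card_subset_eq)
    show "?F ` {\<rho>. \<rho> permutes {1..?s}} \<subseteq> permutations_of_set S"
      using dist set_F by (auto simp del: upt_Suc intro!: permutations_of_setI)
    show "card (?F ` {\<rho>. \<rho> permutes {1..?s}}) = card (permutations_of_set S)"
      unfolding card_image[OF inj] using assms by (simp add: card_permutations[OF refl])
  qed simp
  have linv: "linv (?F \<rho>) = inversions ?s \<rho>" if "\<rho> permutes {1..?s}" for \<rho>
  proof -
    have "linv (?F \<rho>) = card {(i, j). i < j \<and> j < ?s \<and> el S (\<rho> (Suc j)) < el S (\<rho> (Suc i))}"
      unfolding linv_conv_card[OF dist[OF that]]
      by (rule arg_cong[where f = card]) (auto simp del: upt_Suc)
    \<comment> \<open>List positions start at 0 and arguments of permutations at 1, hence the shift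
      by one.\<close>
    also have "\<dots> = card {(i, j). 1 \<le> i \<and> i < j \<and> j \<le> ?s \<and> \<rho> j < \<rho> i}"
    proof (rule bij_betw_same_card[of "\<lambda>(i, j). (Suc i, Suc j)"],
        rule bij_betw_byWitness[where f' = "\<lambda>(i, j). (i - 1, j - 1)"])
      have el: "el S (\<rho> (Suc j)) < el S (\<rho> (Suc i)) \<longleftrightarrow> \<rho> (Suc j) < \<rho> (Suc i)"
        if "i < j" "j < ?s" for i j
        using that by (intro el_less maps[OF \<open>\<rho> permutes {1..?s}\<close>]) auto
      show "(\<lambda>(i, j). (Suc i, Suc j)) ` {(i, j). i < j \<and> j < ?s \<and> el S (\<rho> (Suc j)) < el S (\<rho> (Suc i))}
          \<subseteq> {(i, j). 1 \<le> i \<and> i < j \<and> j \<le> ?s \<and> \<rho> j < \<rho> i}"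
        using el by auto
      show "(\<lambda>(i, j). (i - 1, j - 1)) ` {(i, j). 1 \<le> i \<and> i < j \<and> j \<le> ?s \<and> \<rho> j < \<rho> i}
          \<subseteq> {(i, j). i < j \<and> j < ?s \<and> el S (\<rho> (Suc j)) < el S (\<rho> (Suc i))}"
      proof clarsimp
        fix i j assume "Suc 0 \<le> i" "i < j" "j \<le> ?s" "\<rho> j < \<rho> i"
        then show "i - Suc 0 < j - Suc 0 \<and> j - Suc 0 < ?s \<and> el S (\<rho> j) < el S (\<rho> i)"
          using el[of "i - 1" "j - 1"] by auto
      qed
    qed auto
    finally show ?thesis by (simp add: inversions_def)
  qed
  have sorted: "sorted_list_of_set S = map (el S) [1..<Suc ?s]"
    using assms by (intro nth_equalityI) (auto simp: el_def simp del: upt_Suc)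
  have "rdet S X = (\<Sum>\<rho> | \<rho> permutes {1..?s}. qp (- int (linv (?F \<rho>)))
      * prod_list (map2 X (sorted_list_of_set S) (?F \<rho>)))"
    unfolding rdet_permutations[OF assms]
    by (rule sum.reindex_bij_betw[OF bij, symmetric])
  also have "\<dots> = (\<Sum>\<rho> | \<rho> permutes {1..?s}. sc ((- q) powi (- int (inversions ?s \<rho>)))
      * (\<Prod>i\<leftarrow>[1..<Suc ?s]. X (el S i) (el S (\<rho> i))))"
    unfolding sorted map2_map_map qp_def
    by (rule sum.cong[OF refl]) (simp only: mem_Collect_eq linv)
  finally show ?thesis ..
qed

text \<open>The even factor is ordered by columns, so it is the row determinant of the transpose;
  the odd factor is already ordered by rows.\<close>

lemma alg_hom_Ber:
  assumes f: "alg_hom f" and K: "finite K" "0 \<notin> K"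
    and A: "\<And>a b. a \<in> {1..card K} \<Longrightarrow> b \<in> {1..card K} \<Longrightarrow> f (A0 a b) = A (el K a) (el K b)"
    and B: "\<And>a b. a \<in> {1..card K} \<Longrightarrow> b \<in> {1..card K} \<Longrightarrow> f (B0 a b) = B (el K a) (el K b)"
  shows "f (Ber (num_even m K) (num_odd m K) A0 B0)
    = rdet (K \<inter> {1..m}) (\<lambda>i j. A j i) * rdet (K - {1..m}) B"
proof -
  let ?r = "num_even m K" and ?s = "num_odd m K"
  have rs: "?r + ?s = card K" using num_even_odd K by blast
  have maps: "\<rho> i \<in> {1..r}" if "\<rho> permutes {1..r}" "i \<in> set [1..<Suc r]" for \<rho> i and r :: nat
  proof -
    have "i \<in> {1..r}" using that(2) by auto
    then show ?thesis using that(1) permutes_in_image by metis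
  qed
  have 1: "f (prod_list (map (\<lambda>i. A0 (\<sigma> i) i) [1..<Suc ?r]))
      = (\<Prod>i\<leftarrow>[1..<Suc ?r]. A (el (K \<inter> {1..m}) (\<sigma> i)) (el (K \<inter> {1..m}) i))"
    if "\<sigma> permutes {1..?r}" for \<sigma>
    unfolding alg_hom_prod_list[OF f] map_map comp_def
  proof (rule arg_cong[where f = prod_list], rule map_cong[OF refl])
    fix i assume i: "i \<in> set [1..<Suc ?r]"
    have "i \<in> {1..?r}" "\<sigma> i \<in> {1..?r}"
      using maps[OF that i] i by auto
    then have "\<sigma> i \<in> {1..card K}" "i \<in> {1..card K}"
      "el (K \<inter> {1..m}) (\<sigma> i) = el K (\<sigma> i)" "el (K \<inter> {1..m}) i = el K i"
      using rs el_even[OF K, of _ m] by auto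
    then show "f (A0 (\<sigma> i) i) = A (el (K \<inter> {1..m}) (\<sigma> i)) (el (K \<inter> {1..m}) i)"
      by (simp only: A)
  qed
  have 2: "f (prod_list (map (\<lambda>i. B0 (?r + i) (?r + \<rho> i)) [1..<Suc ?s]))
      = (\<Prod>i\<leftarrow>[1..<Suc ?s]. B (el (K - {1..m}) i) (el (K - {1..m}) (\<rho> i)))"
    if "\<rho> permutes {1..?s}" for \<rho>
    unfolding alg_hom_prod_list[OF f] map_map comp_def
  proof (rule arg_cong[where f = prod_list], rule map_cong[OF refl])
    fix i assume i: "i \<in> set [1..<Suc ?s]"
    have "i \<in> {1..?s}" "\<rho> i \<in> {1..?s}"
      using maps[OF that i] i by auto
    then have "?r + i \<in> {1..card K}" "?r + \<rho> i \<in> {1..card K}"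
      "el (K - {1..m}) (\<rho> i) = el K (?r + \<rho> i)" "el (K - {1..m}) i = el K (?r + i)"
      using rs el_odd[OF K, of _ m] by auto
    then show "f (B0 (?r + i) (?r + \<rho> i)) = B (el (K - {1..m}) i) (el (K - {1..m}) (\<rho> i))"
      by (simp only: B)
  qed
  have even: "f (\<Sum>\<sigma> | \<sigma> permutes {1..?r}.
        scal ((- q) powi (- int (inversions ?r \<sigma>))) * (\<Prod>i\<leftarrow>[1..<Suc ?r]. A0 (\<sigma> i) i))
      = rdet (K \<inter> {1..m}) (\<lambda>i j. A j i)"
    unfolding alg_hom_sum[OF f] rdet_permutes[OF finite_Int[OF disjI1[OF K(1)]], symmetric]
      num_even_def[symmetric]
    by (rule sum.cong[OF refl])
       (simp only: mem_Collect_eq 1 alg_hom_mult[OF f] alg_hom_scal[OF f])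
  have odd: "f (\<Sum>\<rho> | \<rho> permutes {1..?s}.
        scal ((- q) powi (- int (inversions ?s \<rho>))) * (\<Prod>i\<leftarrow>[1..<Suc ?s]. B0 (?r + i) (?r + \<rho> i)))
      = rdet (K - {1..m}) B"
    unfolding alg_hom_sum[OF f] rdet_permutes[OF finite_Diff[OF K(1)], symmetric]
      num_odd_def[symmetric]
    by (rule sum.cong[OF refl])
       (simp only: mem_Collect_eq 2 alg_hom_mult[OF f] alg_hom_scal[OF f])
  show ?thesis
    unfolding Ber_def alg_hom_mult[OF f] even odd ..
qed

section \<open>Schur complements and the Berezinian of a union\<close>

lemma inv_on_sym: "inv_on K A B \<Longrightarrow> inv_on K B A"
  by (auto simp: inv_on_def)

lemma inv_on_cong:
  assumes "\<And>i j. i \<in> K \<Longrightarrow> j \<in> K \<Longrightarrow> A i j = A' i j" "\<And>i j. i \<in> K \<Longrightarrow> j \<in> K \<Longrightarrow> B i j = B' i j"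
  shows "inv_on K A B \<longleftrightarrow> inv_on K A' B'"
  unfolding inv_on_def by (simp add: assms cong: sum.cong)

lemma inv_on_left_cancel:
  assumes "finite K" "inv_on K A B" "i \<in> K"
  shows "(\<Sum>j\<in>K. B i j * (\<Sum>k\<in>K. A j k * v k)) = v i"
proof -
  have "(\<Sum>j\<in>K. B i j * (\<Sum>k\<in>K. A j k * v k)) = (\<Sum>k\<in>K. (\<Sum>j\<in>K. B i j * A j k) * v k)"
    by (simp add: sum_distrib_left sum_distrib_right mult.assoc) (rule sum.swap)
  also have "\<dots> = (\<Sum>k\<in>K. if i = k then v k else 0)"
    using assms by (intro sum.cong) (auto simp: inv_on_def)
  finally show ?thesis using assms by simp
qed

lemma inv_on_right_cancel:
  assumes "finite K" "inv_on K A B" "i \<in> K"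
  shows "(\<Sum>j\<in>K. (\<Sum>k\<in>K. v k * A k j) * B j i) = v i"
proof -
  have "(\<Sum>j\<in>K. (\<Sum>k\<in>K. v k * A k j) * B j i) = (\<Sum>k\<in>K. v k * (\<Sum>j\<in>K. A k j * B j i))"
    by (simp add: sum_distrib_left sum_distrib_right mult.assoc) (rule sum.swap)
  also have "\<dots> = (\<Sum>k\<in>K. if k = i then v k else 0)"
    using assms by (intro sum.cong) (auto simp: inv_on_def)
  finally show ?thesis using assms by simp
qed

lemma inv_on_unique:
  assumes "finite K" "inv_on K A X" "inv_on K B X" "i \<in> K" "j \<in> K"
  shows "A i j = B i j"
proof -
  have "A i j = (\<Sum>k\<in>K. A i k * (\<Sum>l\<in>K. X k l * B l j))"
  proof -
    have "(\<Sum>k\<in>K. A i k * (\<Sum>l\<in>K. X k l * B l j)) = (\<Sum>k\<in>K. if k = j then A i k else 0)"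
      using assms by (intro sum.cong) (auto simp: inv_on_def)
    then show ?thesis using assms by simp
  qed
  also have "\<dots> = B i j"
    by (rule inv_on_left_cancel[OF assms(1) inv_on_sym[OF assms(2)] assms(4)])
  finally show ?thesis .
qed

text \<open>With \<open>Z\<close> the inverse of the block of \<open>A\<close> on \<open>C\<close>,
  this is the Schur complement of that block.\<close>

definition schur :: "nat set \<Rightarrow> 'a::ring_1 mat \<Rightarrow> 'a mat \<Rightarrow> 'a mat" where
  "schur C A Z = (\<lambda>i j. A i j - (\<Sum>b\<in>C. (\<Sum>a\<in>C. A i a * Z a b) * A b j))"

text \<open>Noncommutative block inversion: the block on \<open>J\<close> of the inverse of the
  whole matrix inverts the Schur complement.\<close>

lemma inv_on_schur:
  assumes fin: "finite J" "finite C" and disj: "J \<inter> C = {}"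
    and X: "inv_on (J \<union> C) A X" and Z: "inv_on C A Z"
  shows "inv_on J (schur C A Z) X"
proof -
  have split: "(\<Sum>k\<in>J. g k) = (\<Sum>k\<in>J \<union> C. g k) - (\<Sum>k\<in>C. g k)" for g :: "nat \<Rightarrow> 'a"
    using fin disj by (simp add: sum.union_disjoint)
  have AX: "(\<Sum>k\<in>J \<union> C. A i k * X k j) = (if i = j then 1 else 0)"
    and XA: "(\<Sum>k\<in>J \<union> C. X i k * A k j) = (if i = j then 1 else 0)"
    if "i \<in> J \<union> C" "j \<in> J \<union> C" for i j
    using X that by (auto simp: inv_on_def)
  show ?thesis
    unfolding inv_on_def
  proof (intro ballI conjI)
    fix i j assume i: "i \<in> J" and j: "j \<in> J"
    \<comment> \<open>The entry of the product at (b, j) is 0, since \<open>b\<close> and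
      \<open>j\<close> lie in different blocks; the sum is split accordingly.\<close>
    have off: "(\<Sum>k\<in>J. A b k * X k j) = - (\<Sum>c\<in>C. A b c * X c j)" if "b \<in> C" for b
      using AX[of b j] that j disj split[of "\<lambda>k. A b k * X k j"] by auto
    have "(\<Sum>k\<in>J. schur C A Z i k * X k j) = (\<Sum>k\<in>J. A i k * X k j)
        - (\<Sum>k\<in>J. \<Sum>b\<in>C. (\<Sum>a\<in>C. A i a * Z a b) * (A b k * X k j))"
      by (simp add: schur_def left_diff_distrib sum_subtractf sum_distrib_right mult.assoc)
    also have "(\<Sum>k\<in>J. \<Sum>b\<in>C. (\<Sum>a\<in>C. A i a * Z a b) * (A b k * X k j))
        = (\<Sum>b\<in>C. (\<Sum>a\<in>C. A i a * Z a b) * (\<Sum>k\<in>J. A b k * X k j))"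
      by (subst sum.swap) (simp add: sum_distrib_left)
    also have "\<dots> = - (\<Sum>b\<in>C. (\<Sum>a\<in>C. A i a * Z a b) * (\<Sum>c\<in>C. A b c * X c j))"
      by (simp add: off sum_negf)
    also have "(\<Sum>b\<in>C. (\<Sum>a\<in>C. A i a * Z a b) * (\<Sum>c\<in>C. A b c * X c j))
        = (\<Sum>a\<in>C. A i a * (\<Sum>b\<in>C. Z a b * (\<Sum>c\<in>C. A b c * X c j)))"
      by (simp only: sum_distrib_right[of _ C "sum _ _"] mult.assoc sum_distrib_left[of "A i _"])
         (rule sum.swap)
    also have "\<dots> = (\<Sum>a\<in>C. A i a * X a j)"
      by (intro sum.cong refl arg_cong2[where f = "(*)"] inv_on_left_cancel fin Z)
    finally show "(\<Sum>k\<in>J. schur C A Z i k * X k j) = (if i = j then 1 else 0)"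
      using AX[of i j] i j split[of "\<lambda>k. A i k * X k j"] by simp
  next
    fix i j assume i: "i \<in> J" and j: "j \<in> J"
    have off: "(\<Sum>k\<in>J. X i k * A k b) = - (\<Sum>c\<in>C. X i c * A c b)" if "b \<in> C" for b
      using XA[of i b] that i disj split[of "\<lambda>k. X i k * A k b"] by auto
    have "(\<Sum>k\<in>J. X i k * schur C A Z k j) = (\<Sum>k\<in>J. X i k * A k j)
        - (\<Sum>k\<in>J. \<Sum>b\<in>C. \<Sum>a\<in>C. X i k * (A k a * (Z a b * A b j)))"
      by (simp add: schur_def right_diff_distrib sum_subtractf sum_distrib_right sum_distrib_left
          mult.assoc)
    also have "(\<Sum>k\<in>J. \<Sum>b\<in>C. \<Sum>a\<in>C. X i k * (A k a * (Z a b * A b j)))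
        = (\<Sum>b\<in>C. \<Sum>a\<in>C. \<Sum>k\<in>J. X i k * (A k a * (Z a b * A b j)))"
      by (subst sum.swap) (rule sum.cong[OF refl], rule sum.swap)
    also have "\<dots> = (\<Sum>b\<in>C. (\<Sum>a\<in>C. (\<Sum>k\<in>J. X i k * A k a) * Z a b) * A b j)"
      by (simp only: sum_distrib_right mult.assoc)
    also have "\<dots> = - (\<Sum>b\<in>C. (\<Sum>a\<in>C. (\<Sum>c\<in>C. X i c * A c a) * Z a b) * A b j)"
      by (simp add: off sum_negf)
    also have "(\<Sum>b\<in>C. (\<Sum>a\<in>C. (\<Sum>c\<in>C. X i c * A c a) * Z a b) * A b j)
        = (\<Sum>b\<in>C. X i b * A b j)"
      by (intro sum.cong refl arg_cong2[where f = "(*)"] inv_on_right_cancel fin Z)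
    finally show "(\<Sum>k\<in>J. X i k * schur C A Z k j) = (if i = j then 1 else 0)"
      using XA[of i j] i j split[of "\<lambda>k. X i k * A k j"] by simp
  qed
qed

text \<open>An entry of the Schur complement depends only on the eliminated set
  \<open>V - I\<close>, not on the ambient set. On \<open>I\<close> it equals \<open>P\<close> by
  uniqueness of inverses; restricting to \<open>J\<close> and inverting inside
  \<open>J \<union> (V - I)\<close> gives the claim.\<close>

lemma inv_on_complement:
  assumes X: "\<And>K. K \<subseteq> V \<Longrightarrow> inv_on K A (X K)" and P: "inv_on I (X V) P"
    and "finite V" "I \<subseteq> V" "J \<subseteq> I"
  shows "inv_on J P (X (J \<union> (V - I)))"
proof -
  let ?S = "schur (V - I) A (X (V - I))"
  have fin: "finite I" "finite (V - I)" "finite J"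
    using assms by (auto intro: finite_subset)
  have schur: "inv_on K ?S (X (K \<union> (V - I)))" if "K \<subseteq> I" for K
    using that assms fin finite_subset[of K I] by (intro inv_on_schur X) auto
  have "I \<union> (V - I) = V" using assms by auto
  then have "?S i j = P i j" if "i \<in> I" "j \<in> I" for i j
    using schur[of I] inv_on_sym[OF P] that by (intro inv_on_unique[OF fin(1)]) auto
  then show ?thesis
    using schur[of J] assms(5) inv_on_cong[of J ?S P] by blast
qed

lemma manin_on_mono: "manin_on m K h A \<Longrightarrow> K' \<subseteq> K \<Longrightarrow> manin_on m K' h A"
proof -
  assume A: "manin_on m K h A" and sub: "K' \<subseteq> K"
  have 2: "\<forall>i\<in>K. \<forall>j\<in>K. P i j \<Longrightarrow> \<forall>i\<in>K'. \<forall>j\<in>K'. P i j" for P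
    using sub by blast
  have 3: "\<forall>i\<in>K. \<forall>j\<in>K. \<forall>k\<in>K. P i j k \<Longrightarrow> \<forall>i\<in>K'. \<forall>j\<in>K'. \<forall>k\<in>K'. P i j k" for P
    using sub by blast
  have 4: "\<forall>i\<in>K. \<forall>j\<in>K. \<forall>k\<in>K. \<forall>l\<in>K. P i j k l
      \<Longrightarrow> \<forall>i\<in>K'. \<forall>j\<in>K'. \<forall>k\<in>K'. \<forall>l\<in>K'. P i j k l" for P
    using sub by blast
  show "manin_on m K' h A"
    using A unfolding manin_on_def by (elim conjE, intro conjI) (erule 2, erule 3, erule 3, erule 4)
qed

lemma manin_on_odd_row:
  assumes "manin_on m K h A" "i \<in> K" "k \<in> K" "l \<in> K" "par m i = 1"
  shows "A i k * A i l
        = sc (h powi eps l k * (-1) ^ ((par m k + 1) * (par m l + 1))) * (A i l * A i k)"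
  by (rule assms(1)[unfolded manin_on_def, THEN conjunct2, THEN conjunct1, rule_format])
     (fact assms)+

lemma manin_on_cross:
  assumes "manin_on m K h A" "i \<in> K" "j \<in> K" "k \<in> K" "l \<in> K"
  shows "A i j * A k l
        - sc (h powi (eps i k + eps l j)
                * (-1) ^ ((par m i + par m j) * (par m k + par m l))) * (A k l * A i j)
      = sc (h powi eps i k
                * (-1) ^ (par m i * par m k + par m j * par m k + par m i * par m j))
           * (A k j * A i l)
        - sc (h powi eps l j
                * (-1) ^ (par m j * par m k + par m j * par m l + par m k * par m l))
           * (A i l * A k j)"
  by (rule assms(1)[unfolded manin_on_def, THEN conjunct2, THEN conjunct2, THEN conjunct2, rule_format])
     (fact assms)+

text \<open>For odd indices relation (2) says that row forms square to zero, and relation (4) is the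
  exchange rule of two rows.\<close>

lemma manin_on_qrows:
  assumes B: "manin_on m K (inverse q) B" and odd: "\<And>i. i \<in> K \<Longrightarrow> par m i = 1"
  shows "qrows K K B"
proof -
  have qp: "qp (- 1) = - sc (inverse q)"
    by (simp add: qp_def power_int_minus sc_minus)
  have eps: "eps i j = -1" "eps j i = 1" if "i < j" for i j
    using that by (auto simp: eps_def)
  have "B i k * B i l + qp (- 1) * (B i l * B i k) = 0"
    if "i \<in> K" "k \<in> K" "l \<in> K" "k < l" for i k l
  proof -
    have "B i k * B i l = sc (inverse q powi eps l k * (-1) ^ ((par m k + 1) * (par m l + 1)))
        * (B i l * B i k)"
      by (rule manin_on_odd_row[OF B]) (use that odd in auto)
    then show ?thesis using that odd by (simp add: eps qp)
  qed
  moreover have "B j k * B i l + qp (- 1) * (B j l * B i k)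
        = qp (- 1) * (B i k * B j l + qp (- 1) * (B i l * B j k))"
    if "i \<in> K" "j \<in> K" "k \<in> K" "l \<in> K" "i < j" "k < l" for i j k l
  \<comment> \<open>For \<open>i < j\<close> and \<open>k < l\<close> the two powers of
    \<open>q\<close> on the left of relation (4) cancel, and both signs on the right come from the
    exponent 3.\<close>
  proof -
    have "B i k * B j l
        - sc (inverse q powi (eps i j + eps l k)
                * (-1) ^ ((par m i + par m k) * (par m j + par m l))) * (B j l * B i k)
      = sc (inverse q powi eps i j
                * (-1) ^ (par m i * par m j + par m k * par m j + par m i * par m k))
           * (B j k * B i l)
        - sc (inverse q powi eps l k
                * (-1) ^ (par m k * par m j + par m k * par m l + par m j * par m l))
           * (B i l * B j k)"
      by (rule manin_on_cross[OF B]) (use that in auto)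
    then have *: "B i k * B j l = B j l * B i k - sc q * (B j k * B i l) + sc (inverse q) * (B i l * B j k)"
      using that odd
      by (simp add: eps power_int_minus sc_minus eval_nat_numeral algebra_simps)
    have "sc (inverse q) * (sc q * x) = x" for x :: 'a
      by (simp flip: mult.assoc sc_mult)
    then show ?thesis
      unfolding * qp by (simp add: algebra_simps)
  qed
  ultimately show ?thesis
    unfolding qrows_def by blast
qed

text \<open>An arbitrary algebra in which the standing conventions hold; the quotient map of the
  presented algebra is the instance used at the end.\<close>

locale universal_image =
  fixes m n :: nat and f :: "generator free_alg \<Rightarrow> 'a::cq_algebra"
  assumes hom: "alg_hom f" and rels: "x \<in> universal_rels m n \<Longrightarrow> f x = 0"
begin

definition V where "V = {1..m + n}"

definition Mf where "Mf i j = f (M i j)"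

text \<open>\<open>MI K\<close> and \<open>WI K\<close> are the inverses of \<open>M\<^sub>K\<close> and \<open>(M\<^sup>-\<^sup>1)\<^sub>K\<close>, with entries
  indexed by the elements of \<open>K\<close> instead of their positions in \<open>K\<close>.\<close>

definition MI where "MI K i j = f (MsubInv K (pos K i) (pos K j))"

definition WI where "WI K i j = f (MinvSubInv K (pos K i) (pos K j))"

lemma finite_sub_V: "K \<subseteq> V \<Longrightarrow> finite K" and zero_sub_V: "K \<subseteq> V \<Longrightarrow> 0 \<notin> K"
  by (auto simp: V_def intro: finite_subset)

lemma el_V: "i \<in> V \<Longrightarrow> el V i = i"
proof -
  assume i: "i \<in> V"
  have "sorted_list_of_set V = [1..<Suc (m + n)]"
    unfolding V_def atLeastLessThanSuc_atLeastAtMost[symmetric] by (rule sorted_list_of_set_range)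
  then show ?thesis
    using i by (auto simp: el_def V_def simp del: upt_Suc)
qed

lemma pos_V: "i \<in> V \<Longrightarrow> pos V i = i"
  using pos_el[of i V] el_V[of i] by (simp add: V_def)

lemma tilde_M:
  assumes K: "K \<subseteq> V"
  shows "tilde_on m K q Mf (MI K)"
proof -
  note K' = finite_sub_V[OF K] zero_sub_V[OF K]
  have "f x = 0" if "x \<in> tilde_rels (num_even m K) (num_odd m K) q (submat K M) (MsubInv K)" for x
    using that K by (intro rels) (auto simp: universal_rels_def V_def)
  then show ?thesis
    by (subst tilde_rels_iff[OF hom K', symmetric, of "submat K M" _ "MsubInv K"])
       (auto simp: submat_def el_def[symmetric] Mf_def MI_def pos_el simp del: One_nat_def)
qed

lemma tilde_Minv:
  assumes K: "K \<subseteq> V"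
  shows "tilde_on m K (inverse q) (MI V) (WI K)"
proof -
  note K' = finite_sub_V[OF K] zero_sub_V[OF K]
  have "f x = 0" if "x \<in> tilde_rels (num_even m K) (num_odd m K) (inverse q) (submat K (Minv m n)) (MinvSubInv K)" for x
    using that K by (intro rels) (auto simp: universal_rels_def V_def)
  moreover have "el K a \<in> V" if "a \<in> {1..card K}" for a
    using el_in[OF K'(1) that] K by blast
  ultimately show ?thesis
    by (subst tilde_rels_iff[OF hom K', symmetric, of "submat K (Minv m n)" _ "MinvSubInv K"])
       (auto simp: submat_def el_def[symmetric] Minv_def MI_def WI_def pos_el pos_V
         V_def[symmetric] simp del: One_nat_def)
qed

lemma f_BerM:
  assumes K: "K \<subseteq> V"
  shows "f (BerM m K) = rdet (K \<inter> {1..m}) (\<lambda>i j. Mf j i) * rdet (K - {1..m}) (MI K)"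
  unfolding BerM_def
  by (rule alg_hom_Ber[OF hom finite_sub_V[OF K] zero_sub_V[OF K]])
     (auto simp: submat_def el_def[symmetric] Mf_def MI_def pos_el simp del: One_nat_def)

lemma f_BerMInv:
  assumes K: "K \<subseteq> V"
  shows "f (BerM m K) * f (BerMInv K) = 1" "f (BerMInv K) * f (BerM m K) = 1"
proof -
  have "f (BerM m K * BerMInv K - 1) = 0" "f (BerMInv K * BerM m K - 1) = 0"
    using K by (auto simp: universal_rels_def V_def intro!: rels)
  then show "f (BerM m K) * f (BerMInv K) = 1" "f (BerMInv K) * f (BerM m K) = 1"
    by (simp_all add: alg_hom_diff[OF hom] alg_hom_mult[OF hom] alg_hom_1[OF hom])
qed

end

locale universal_image_odd = universal_image +
  fixes I :: "nat set"
  assumes I: "I \<subseteq> {1..m+n} - {1..m}"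
begin

definition C where "C = V - I"

lemma I_V: "I \<subseteq> V" and C_V: "C \<subseteq> V" and I_C: "I \<inter> C = {}" and V_split: "I \<union> C = V"
  using I by (auto simp: V_def C_def)

lemma par_I: "i \<in> I \<Longrightarrow> par m i = 1"
  using I by (auto simp: par_def)

text \<open>\<open>WI I\<close> is the matrix N of the overview. Over a noncommutative ring,
  supertransposing does not in general preserve inverses, so the Schur complement argument is run a
  second time on the supertransposes, whose inverses the relations supply for every
  submatrix.\<close>

lemma quasi_inv:
  assumes "J \<subseteq> I"
  shows "inv_on J (WI I) (MI (J \<union> C))"
    and "inv_on J (st m (WI I)) (st m (MI (J \<union> C)))"
proof -
  have V: "finite V" by (simp add: V_def)
  show "inv_on J (WI I) (MI (J \<union> C))"
    unfolding C_def
    by (rule inv_on_complement[OF _ _ V I_V assms, of Mf])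
       (use tilde_M tilde_Minv[OF I_V] in \<open>auto simp: tilde_on_def\<close>)
  show "inv_on J (st m (WI I)) (st m (MI (J \<union> C)))"
    unfolding C_def
    by (rule inv_on_complement[OF _ _ V I_V assms, of "st m Mf" "\<lambda>K. st m (MI K)"])
       (use tilde_M tilde_Minv[OF I_V] in \<open>auto simp: tilde_on_def\<close>)
qed

text \<open>The block of the inverse of \<open>M\<close> obeys the relations for 1/q, so its inverse
  obeys those for \<open>q\<close>; these restrict to \<open>J\<close>.\<close>

lemma tilde_quasi:
  assumes "J \<subseteq> I"
  shows "tilde_on m J q (WI I) (MI (J \<union> C))"
proof -
  have "manin_on m I (inverse (inverse q)) (WI I)"
    using tilde_Minv[OF I_V] unfolding tilde_on_def by blast
  moreover have "manin_on m (J \<union> C) (inverse q) (MI (J \<union> C))"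
    using tilde_M[of "J \<union> C"] assms I_V C_V unfolding tilde_on_def by blast
  ultimately show ?thesis
    unfolding tilde_on_def using assms quasi_inv[OF assms]
    by (auto intro: manin_on_mono)
qed

text \<open>The even factor is that of \<open>C\<close>. For the odd factor the rows of
  \<open>J\<close> are used to eliminate in the inverse of M_{J \<union> C}.\<close>

theorem f_BerM_union:
  assumes J: "J \<subseteq> I"
  shows "f (BerM m (J \<union> C)) = f (BerM m C) * rdet J (MI (J \<union> C))"
proof -
  let ?X = "MI (J \<union> C)" and ?O = "C - {1..m}"
  have JC: "J \<union> C \<subseteq> V" and disj: "J \<inter> C = {}" using J I_V C_V I_C by auto
  have fin: "finite J" "finite C" "finite ?O" using JC finite_sub_V by auto
  have inv: "inv_on J (WI I) ?X" by (rule quasi_inv[OF J])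
  have X: "inv_on (C \<union> J) ?X Mf"
    using tilde_M[OF JC] by (auto simp: tilde_on_def Un_commute intro: inv_on_sym)
  \<comment> \<open>Block inversion with the roles exchanged: \<open>J\<close> is eliminated from
    \<open>?X\<close>, whose inverse \<open>Mf\<close> restricts to M_C. So the Schur complement is
    the inverse of M_C, taken on all of \<open>C\<close>; only its odd block enters below.\<close>
  have "inv_on C (schur J ?X (WI I)) Mf"
    by (rule inv_on_schur) (use fin disj X inv in \<open>auto intro: inv_on_sym\<close>)
  moreover have "inv_on C (MI C) Mf"
    using tilde_M[OF C_V] by (auto simp: tilde_on_def intro: inv_on_sym)
  ultimately have schur: "schur J ?X (WI I) a k = MI C a k" if "a \<in> C" "k \<in> C" for a k
    using inv_on_unique[OF fin(2)] that by blast
  \<comment> \<open>The elimination coefficients are the rows of \<open>?X\<close> on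
    \<open>J\<close> times the inverse of its block on \<open>J\<close>, which is
    \<open>WI I\<close> there.\<close>
  have "rdet (?O \<union> J) ?X = rdet ?O (MI C) * rdet J ?X"
  proof (rule rdet_schur[where c = "\<lambda>a j. \<Sum>i\<in>J. ?X a i * WI I i j"])
    have "manin_on m (?O \<union> J) (inverse q) ?X"
      using tilde_M[OF JC] by (auto simp: tilde_on_def intro: manin_on_mono)
    moreover have "par m i = 1" if "i \<in> ?O \<union> J" for i
    proof (cases "i \<in> J")
      case True
      then show ?thesis using J par_I by blast
    next
      case False
      then show ?thesis using that C_V by (auto simp: par_def V_def)
    qed
    ultimately show "qrows (?O \<union> J) (?O \<union> J) ?X" by (rule manin_on_qrows)
    show "?X a k = (\<Sum>j\<in>J. (\<Sum>i\<in>J. ?X a i * WI I i j) * ?X j k)" if "a \<in> ?O" "k \<in> J" for a k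
      using inv_on_right_cancel[OF fin(1) inv that(2)] by simp
    show "?X a k = MI C a k + (\<Sum>j\<in>J. (\<Sum>i\<in>J. ?X a i * WI I i j) * ?X j k)"
      if "a \<in> ?O" "k \<in> ?O" for a k
      using schur[of a k] that by (auto simp: schur_def algebra_simps)
  qed (use fin disj in auto)
  moreover have "(J \<union> C) \<inter> {1..m} = C \<inter> {1..m}" "(J \<union> C) - {1..m} = ?O \<union> J"
    using J I by auto
  ultimately show ?thesis
    by (simp only: f_BerM[OF JC] f_BerM[OF C_V] mult.assoc)
qed

end

section \<open>Twisted multiplications and shifts\<close>

text \<open>Additivity makes composition distribute over sums, and compatibility with
  \<open>sc\<close> makes scalars central; so the operators form an algebra of the same class and
  all lemmas apply to them again.\<close>

typedef (overloaded) 'a::cq_algebra op =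
  "{F :: ((nat \<Rightarrow> int) \<Rightarrow> 'a) \<Rightarrow> (nat \<Rightarrow> int) \<Rightarrow> 'a.
     (\<forall>u v. F (\<lambda>d. u d + v d) = (\<lambda>d. F u d + F v d)) \<and>
     (\<forall>c u. F (\<lambda>d. sc c * u d) = (\<lambda>d. sc c * F u d))}"
  morphisms app Op
  by (rule exI[of _ "\<lambda>u. u"]) simp

setup_lifting type_definition_op

lemma app_add: "app F (\<lambda>d. u d + v d) = (\<lambda>d. app F u d + app F v d)"
  and app_sc: "app F (\<lambda>d. sc c * u d) = (\<lambda>d. sc c * app F u d)"
  using app[of F] by auto

lemma op_eqI: "(\<And>u d. app F u d = app G u d) \<Longrightarrow> F = G"
  by (metis app_inject ext)

instantiation op :: (cq_algebra) cq_algebra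
begin

lift_definition zero_op :: "'a op" is "\<lambda>u d. 0" by simp
lift_definition one_op :: "'a op" is "\<lambda>u. u" by simp
lift_definition plus_op :: "'a op \<Rightarrow> 'a op \<Rightarrow> 'a op" is "\<lambda>F G u d. F u d + G u d"
  by (auto simp: fun_eq_iff distrib_left)
lift_definition minus_op :: "'a op \<Rightarrow> 'a op \<Rightarrow> 'a op" is "\<lambda>F G u d. F u d - G u d"
  by (auto simp: fun_eq_iff right_diff_distrib)
lift_definition uminus_op :: "'a op \<Rightarrow> 'a op" is "\<lambda>F u d. - F u d"
  by auto
lift_definition times_op :: "'a op \<Rightarrow> 'a op \<Rightarrow> 'a op" is "\<lambda>F G u. F (G u)"
  by auto
lift_definition sc_op :: "Cq \<Rightarrow> 'a op" is "\<lambda>c u d. sc c * u d"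
  by (auto simp: fun_eq_iff distrib_left sc_sc_left mult.commute)

instance
proof
  fix F G H :: "'a op" and a b :: Cq
  note app_simps = zero_op.rep_eq one_op.rep_eq plus_op.rep_eq minus_op.rep_eq uminus_op.rep_eq
    times_op.rep_eq sc_op.rep_eq
  show "F * G * H = F * (G * H)" by (rule op_eqI) (simp add: app_simps)
  show "F + G + H = F + (G + H)" by (rule op_eqI) (simp add: app_simps)
  show "F + G = G + F" by (rule op_eqI) (simp add: app_simps add.commute)
  show "0 + F = F" by (rule op_eqI) (simp add: app_simps)
  show "- F + F = 0" by (rule op_eqI) (simp add: app_simps)
  show "F - G = F + - G" by (rule op_eqI) (simp add: app_simps)
  show "1 * F = F" "F * 1 = F" by (rule op_eqI, simp add: app_simps)+
  show "(F + G) * H = F * H + G * H" by (rule op_eqI) (simp add: app_simps)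
  show "F * (G + H) = F * G + F * H" by (rule op_eqI) (simp add: app_simps app_add)
  show "(0::'a op) \<noteq> 1"
  proof
    assume "(0::'a op) = 1"
    then have "app 0 (\<lambda>_. 1) (\<lambda>_. 0) = app (1::'a op) (\<lambda>_. 1) (\<lambda>_. 0)" by simp
    then show False by (simp add: app_simps)
  qed
  show "sc (a + b) = (sc a + sc b :: 'a op)"
    by (rule op_eqI) (simp add: app_simps sc_add distrib_right)
  show "sc (a * b) = (sc a * sc b :: 'a op)"
    by (rule op_eqI) (simp add: app_simps sc_mult mult.assoc)
  show "sc 1 = (1 :: 'a op)"
    by (rule op_eqI) (simp add: app_simps)
  show "F * sc a = sc a * F"
    by (rule op_eqI) (simp add: app_simps app_sc)
qed

end

lemmas app_simps = zero_op.rep_eq one_op.rep_eq plus_op.rep_eq minus_op.rep_eq uminus_op.rep_eq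
  times_op.rep_eq sc_op.rep_eq

lift_definition shift :: "(nat \<Rightarrow> int) \<Rightarrow> 'a::cq_algebra op" is
  "\<lambda>e u d. u (\<lambda>i. d i + e i)"
  by auto

lift_definition mul :: "((nat \<Rightarrow> int) \<Rightarrow> int) \<Rightarrow> 'a::cq_algebra \<Rightarrow> 'a op" is
  "\<lambda>w x u d. sc (q powi w d) * (x * u d)"
  by (auto simp: fun_eq_iff distrib_left) (metis sc_left_commute)

lemma shift_shift: "shift e * shift e' = shift (\<lambda>i. e i + e' i)"
  by (rule op_eqI) (simp add: app_simps shift.rep_eq add.assoc)

lemma shift_0: "shift (\<lambda>i. 0) = 1"
  by (rule op_eqI) (simp add: app_simps shift.rep_eq)

lemma mul_mul: "mul w x * mul w' y = mul (\<lambda>d. w d + w' d) (x * y)"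
  by (rule op_eqI)
     (simp add: app_simps mul.rep_eq sc_left_commute[of x] sc_sc_left power_int_add mult.assoc)

lemma mul_add: "mul w (x + y) = mul w x + mul w y"
  by (rule op_eqI) (simp add: app_simps mul.rep_eq distrib_left distrib_right)

lemma mul_0_right [simp]: "mul w 0 = 0"
  by (rule op_eqI) (simp add: app_simps mul.rep_eq)

lemma mul_1: "mul (\<lambda>d. 0) 1 = 1"
  by (rule op_eqI) (simp add: app_simps mul.rep_eq)

lemma mul_sc: "mul w (sc c * x) = sc c * mul w x"
  by (rule op_eqI) (simp add: app_simps mul.rep_eq mult.assoc sc_sc_left mult.commute)

lemma mul_diff: "mul w (x - y) = mul w x - mul w y"
  using mul_add[of w "x - y" y] by simp

lemma mul_sum: "mul w (\<Sum>a\<in>A. g a) = (\<Sum>a\<in>A. mul w (g a))"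
  by (induction A rule: infinite_finite_induct) (simp_all add: mul_add)

lemma mul_prod_list: "mul (\<lambda>d. 0) (prod_list xs) = prod_list (map (mul (\<lambda>d. 0)) xs)"
  by (induction xs) (simp_all add: mul_1 flip: mul_mul[of "\<lambda>d. 0" _ "\<lambda>d. 0", simplified])

text \<open>Weight 0 makes the representation faithful: the constant function 1 at the origin
  returns \<open>x\<close>.\<close>

lemma mul_eq_0D: "mul (\<lambda>d. 0) x = 0 \<Longrightarrow> x = 0"
proof -
  assume "mul (\<lambda>d. 0) x = 0"
  then have "app (mul (\<lambda>d. 0) x) (\<lambda>_. 1) (\<lambda>_. 0) = 0"
    by (simp add: app_simps)
  then show ?thesis by (simp add: mul.rep_eq)
qed

lemma shift_mul:
  "shift e * mul (\<lambda>d. d l - d k) x = sc (q powi (e l - e k)) * (mul (\<lambda>d. d l - d k) x * shift e)"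
proof (rule op_eqI)
  fix u :: "(nat \<Rightarrow> int) \<Rightarrow> 'a" and d
  have "q powi (d l + e l - (d k + e k)) = q powi (e l - e k) * q powi (d l - d k)"
    by (simp add: algebra_simps flip: power_int_add)
  then show "app (shift e * mul (\<lambda>d. d l - d k) x) u d
    = app (sc (q powi (e l - e k)) * (mul (\<lambda>d. d l - d k) x * shift e)) u d"
    by (simp add: app_simps shift.rep_eq mul.rep_eq sc_sc_left)
qed

text \<open>Block diagonal: twisted \<open>X\<close> on \<open>I\<close>, the shifts T_c of the
  overview elsewhere. The sign \<open>s\<close> selects the parameter \<open>q powi s\<close>, so
  matrix and inverse use opposite shifts. The sign \<open>g\<close> is there because
  supertransposing exchanges row and column weights.\<close>

definition bd :: "nat set \<Rightarrow> int \<Rightarrow> int \<Rightarrow> 'a::cq_algebra mat \<Rightarrow> 'a op mat" where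
  "bd I g s X i j =
     (if i \<in> I \<and> j \<in> I then mul (\<lambda>d. g * (d j - d i)) (X i j)
      else if i = j then shift (\<lambda>k. s * eps k i) else 0)"

lemma bd_in: "i \<in> I \<Longrightarrow> j \<in> I \<Longrightarrow> bd I g s X i j = mul (\<lambda>d. g * (d j - d i)) (X i j)"
  and bd_diag: "i \<notin> I \<Longrightarrow> bd I g s X i i = shift (\<lambda>k. s * eps k i)"
  and bd_off: "i \<noteq> j \<Longrightarrow> i \<notin> I \<or> j \<notin> I \<Longrightarrow> bd I g s X i j = 0"
  by (auto simp: bd_def)

lemma bd_diag_comm:
  "c \<notin> I \<Longrightarrow> c' \<notin> I \<Longrightarrow> bd I g s X c c * bd I g s X c' c' = bd I g s X c' c' * bd I g s X c c"
  by (simp add: bd_diag shift_shift add.commute)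

lemma bd_comm:
  assumes "c \<notin> I" "k \<in> I" "l \<in> I"
  shows "bd I 1 s X c c * bd I 1 s X k l
    = sc ((q powi s) powi (eps l c - eps k c)) * (bd I 1 s X k l * bd I 1 s X c c)"
  using assms shift_mul[of "\<lambda>k. s * eps k c" l k "X k l"]
  by (simp add: bd_in bd_diag right_diff_distrib flip: power_int_mult)

text \<open>The weight is symmetric in the two rows and in the two columns, so it is common to all
  terms of a quadratic relation.\<close>

lemma bd_mult_in:
  "i \<in> I \<Longrightarrow> j \<in> I \<Longrightarrow> k \<in> I \<Longrightarrow> l \<in> I \<Longrightarrow> bd I 1 s X i j * bd I 1 s X k l
    = mul (\<lambda>d. d j + d l - d i - d k) (X i j * X k l)"
  by (simp add: bd_in mul_mul algebra_simps)

lemma eps_swap: "eps a b = - eps b a"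
  by (cases a b rule: linorder_cases) (auto simp: eps_def)

text \<open>Inside \<open>I\<close> the common weight factors out of every relation. Otherwise a
  product of entries is zero or involves a shift, and then \<open>bd_comm\<close> or commuting
  shifts give relation (4).\<close>

lemma manin_on_bd:
  assumes X: "manin_on m (K \<inter> I) (q powi s) X" and odd: "\<And>i. i \<in> I \<Longrightarrow> par m i = 1"
  shows "manin_on m K (q powi s) (bd I 1 s X)"
proof -
  let ?A = "bd I 1 s X" and ?h = "q powi s"
  have par: "par m i = 0 \<or> par m i = 1" for i by (simp add: par_def)
  have h: "?h \<noteq> 0" by simp
  have row: "?A i k * ?A i l
        = sc (?h powi eps l k * (-1) ^ ((par m k + 1) * (par m l + 1))) * (?A i l * ?A i k)"
    if K: "i \<in> K" "k \<in> K" "l \<in> K" and i: "par m i = 1" for i k l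
  proof -
    consider "i \<in> I" "k \<in> I" "l \<in> I" | "i \<in> I" "k \<notin> I \<or> l \<notin> I"
      | "i \<notin> I" "k = i" "l = i" | "i \<notin> I" "k \<noteq> i \<or> l \<noteq> i"
      by blast
    then show ?thesis
    proof cases
      case 1
      have "X i k * X i l = sc (?h powi eps l k * (-1) ^ ((par m k + 1) * (par m l + 1))) * (X i l * X i k)"
        using K i 1 by (intro manin_on_odd_row[OF X]) auto
      moreover have "(\<lambda>d. d k + d l - d i - d i) = (\<lambda>d. d l + d k - d i - d i :: int)" by auto
      ultimately show ?thesis using 1 by (simp only: bd_mult_in mul_sc)
    next
      case 2
      then have "?A i k = 0 \<or> ?A i l = 0" by (auto simp: bd_def)
      then show ?thesis by auto
    next
      case 3
      then show ?thesis using i by (simp add: eps_def)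
    next
      case 4
      then have "?A i k = 0 \<or> ?A i l = 0" by (auto simp: bd_def)
      then show ?thesis by auto
    qed
  qed
  have col: "?A i k * ?A j k = sc (?h powi eps i j * (-1) ^ (par m i * par m j)) * (?A j k * ?A i k)"
    if "par m k = 0" for i j k
  proof (cases "i = k \<and> j = k")
    case True
    then show ?thesis using that by (simp add: eps_def)
  next
    case False
    have "k \<notin> I" using that odd by force
    then have "?A i k = 0 \<or> ?A j k = 0" using False by (auto simp: bd_def)
    then show ?thesis by auto
  qed
  have cross: "?A i j * ?A k l
        - sc (?h powi (eps i k + eps l j)
                * (-1) ^ ((par m i + par m j) * (par m k + par m l))) * (?A k l * ?A i j)
      = sc (?h powi eps i k
                * (-1) ^ (par m i * par m k + par m j * par m k + par m i * par m j))
           * (?A k j * ?A i l)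
        - sc (?h powi eps l j
                * (-1) ^ (par m j * par m k + par m j * par m l + par m k * par m l))
           * (?A i l * ?A k j)" (is "?lhs = ?rhs")
    if K: "i \<in> K" "j \<in> K" "k \<in> K" "l \<in> K" for i j k l
  proof (cases "i \<in> I \<and> j \<in> I \<and> k \<in> I \<and> l \<in> I")
    case True
    let ?w = "\<lambda>d. d j + d l - d i - d k :: int"
    have w: "(\<lambda>d. d l + d j - d k - d i) = ?w" "(\<lambda>d. d j + d l - d k - d i) = ?w"
      "(\<lambda>d. d l + d j - d i - d k) = ?w" by auto
    show ?thesis
      using True K
      by (simp only: bd_mult_in w mul_sc[symmetric] mul_diff[symmetric] manin_on_cross[OF X] Int_iff)
  next
    case notall: False
    show ?thesis
    proof (cases "i = j \<and> i \<notin> I")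
      case True
      then have ij: "i \<notin> I" "j = i" by auto
      consider "k \<in> I" "l \<in> I" | "k = l" "k \<notin> I" "k \<noteq> i" | "k = i" "l = i"
        | "k \<noteq> l" "k \<notin> I \<or> l \<notin> I" using ij by blast
      then show ?thesis
      proof cases
        case 1
        \<comment> \<open>Both terms on the right contain this entry; what remains is exactly the
          commutation of a shift with a twisted entry.\<close>
        have "?A k j = 0" using ij 1 by (auto intro!: bd_off)
        moreover have "eps i k + eps l i = eps l i - eps k i" by (simp add: eps_swap[of i k])
        ultimately show ?thesis using ij 1 by (simp add: bd_comm odd)
      next
        case 2
        have "?A k j = 0" using ij 2 by (auto intro!: bd_off)
        moreover have "?A i j * ?A k l = ?A k l * ?A i j"
          using ij 2 by (simp add: bd_diag_comm)
        moreover have "eps i k + eps l j = 0" using ij 2 eps_swap[of i k] by simp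
        ultimately show ?thesis using par[of i] par[of k] ij 2 by auto
      next
        case 3
        \<comment> \<open>All four indices agree, and each side is a difference of two equal
          multiples of a square.\<close>
        then show ?thesis using ij par[of i] by (auto simp: eps_def)
      next
        case 4
        have "?A k l = 0" using 4 by (auto intro!: bd_off)
        moreover have "?A k j = 0 \<or> ?A i l = 0" using 4 ij by (auto simp: bd_def)
        ultimately show ?thesis by auto
      qed
    next
      case ij: False
      show ?thesis
      proof (cases "i \<in> I \<and> j \<in> I")
        case True
        show ?thesis
        proof (cases "k = l")
          case kl: True
          then have k: "k \<notin> I" using notall True by blast
          \<comment> \<open>The mirror image of the previous commutation: the shift is now the
            second factor, so the inverse power is needed.\<close>
          have "?A k j = 0" using True k by (auto intro!: bd_off)
          moreover have "?h powi (eps i k + eps k j) * ?h powi (eps j k - eps i k) = 1"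
            using eps_swap[of k j] by (simp flip: power_int_add)
          ultimately show ?thesis
            using True k kl by (simp add: bd_comm odd sc_sc_left)
        next
          case False
          have "?A k l = 0" using notall True False by (auto intro!: bd_off)
          moreover have "?A k j = 0 \<or> ?A i l = 0" using notall True by (auto simp: bd_def)
          ultimately show ?thesis by auto
        qed
      next
        case False
        \<comment> \<open>The left side vanishes, so the two terms on the right have to cancel each
          other.\<close>
        then have Aij: "?A i j = 0" using ij by (auto intro!: bd_off)
        have nz: "?A a b = 0 \<or> (a \<in> I \<and> b \<in> I) \<or> (a = b \<and> a \<notin> I)" for a b
          using bd_off[of a b I 1 s X] by metis
        consider "k \<in> I" "j \<in> I" "i = l" "i \<notin> I" | "k = j" "k \<notin> I" "i \<in> I" "l \<in> I"
          | "k = j" "k \<notin> I" "i = l" "i \<notin> I" | "?A k j = 0 \<or> ?A i l = 0"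
          using nz[of k j] nz[of i l] False by metis
        then show ?thesis
        proof cases
          case 1
          have "?h powi eps i j * ?h powi (eps j i - eps k i) = ?h powi eps i k"
            using eps_swap[of i j] eps_swap[of i k] by (simp flip: power_int_add)
          then show ?thesis
            using 1 Aij par[of i] by (auto simp: bd_comm odd sc_sc_left)
        next
          case 2
          have "?h powi eps i k * ?h powi (eps l k - eps i k) = ?h powi eps l k"
            by (simp flip: power_int_add)
          then show ?thesis
            using 2 Aij par[of k] by (auto simp: bd_comm odd sc_sc_left)
        next
          case 3
          then have "?A k j * ?A i l = ?A i l * ?A k j" by (simp add: bd_diag_comm)
          then show ?thesis
            using 3 Aij par[of k] par[of i] by auto
        next
          case 4
          then show ?thesis using Aij by auto
        qed
      qed
    qed
  qed
  have "?A i j * ?A i j = 0" if "par m i = 1" "par m j = 0" for i j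
    using that odd bd_off[of i j I 1 s X] by force
  then show ?thesis
    unfolding manin_on_def using row col cross by blast
qed

text \<open>Weights telescope along a matrix product, from \<open>i\<close> to \<open>k\<close> to
  \<open>j\<close>, and opposite shifts cancel.\<close>

lemma inv_on_bd:
  assumes "inv_on (K \<inter> I) A B" "finite K"
  shows "inv_on K (bd I g s A) (bd I g (- s) B)"
proof -
  have *: "(\<Sum>k\<in>K. bd I g s A i k * bd I g (- s) B k j) = (if i = j then 1 else 0)"
    if AB: "\<And>i j. i \<in> K \<inter> I \<Longrightarrow> j \<in> K \<inter> I \<Longrightarrow> (\<Sum>k\<in>K \<inter> I. A i k * B k j) = (if i = j then 1 else 0)"
      and ij: "i \<in> K" "j \<in> K" for A B :: "'a mat" and s i j
  proof (cases "i \<in> I")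
    case True
    have "(\<Sum>k\<in>K. bd I g s A i k * bd I g (- s) B k j)
        = (\<Sum>k\<in>K \<inter> I. bd I g s A i k * bd I g (- s) B k j)"
      by (rule sum.mono_neutral_right) (use assms(2) True in \<open>auto simp: bd_def\<close>)
    also have "\<dots> = (if i = j then 1 else 0)"
    proof (cases "j \<in> I")
      case j: True
      have "(\<Sum>k\<in>K \<inter> I. bd I g s A i k * bd I g (- s) B k j)
          = (\<Sum>k\<in>K \<inter> I. mul (\<lambda>d. g * (d j - d i)) (A i k * B k j))"
      proof (rule sum.cong[OF refl])
        fix k assume "k \<in> K \<inter> I"
        moreover have "(\<lambda>d. g * (d k - d i) + g * (d j - d k)) = (\<lambda>d. g * (d j - d i))"
          by (auto simp: algebra_simps)
        ultimately show "bd I g s A i k * bd I g (- s) B k j = mul (\<lambda>d. g * (d j - d i)) (A i k * B k j)"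
          using True j by (simp only: bd_in mul_mul Int_iff)
      qed
      also have "\<dots> = mul (\<lambda>d. g * (d j - d i)) (if i = j then 1 else 0)"
        using AB[of i j] True j ij by (simp flip: mul_sum)
      finally show ?thesis by (auto simp: mul_1)
    next
      case False
      then have "bd I g (- s) B k j = 0" if "k \<in> K \<inter> I" for k
        using that by (intro bd_off) auto
      then show ?thesis using True False by auto
    qed
    finally show ?thesis .
  next
    case False
    have "(\<Sum>k\<in>K. bd I g s A i k * bd I g (- s) B k j)
        = (\<Sum>k\<in>{i}. bd I g s A i k * bd I g (- s) B k j)"
      by (rule sum.mono_neutral_right) (use assms(2) False ij in \<open>auto simp: bd_def\<close>)
    also have "\<dots> = (if i = j then 1 else 0)"
      using False by (auto simp: bd_def shift_shift shift_0)
    finally show ?thesis .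
  qed
  show ?thesis
    unfolding inv_on_def
    using *[of A B _ _ s] *[of B A _ _ "- s"] assms(1) by (simp add: inv_on_def)
qed

text \<open>Rows and columns change places, which reverses the weights; diagonal signs have even
  exponent.\<close>

lemma st_bd:
  "st m (bd I g s X) = bd I (- g) s (st m X)"
proof (intro ext)
  fix i j
  have *: "mul w ((-1) ^ k * x) = (-1) ^ k * mul w x" for w k and x :: 'a
    by (metis mul_sc sc_neg_one_power)
  have "(-1) ^ (par m i * (par m i + par m i)) = (1 :: 'a op)" by (simp flip: mult_2)
  moreover have "(\<lambda>d. g * (d i - d j)) = (\<lambda>d. - g * (d j - d i))"
    by (auto simp: algebra_simps)
  ultimately show "st m (bd I g s X) i j = bd I (- g) s (st m X) i j"
    by (simp add: st_def bd_def *)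
qed

lemma tilde_on_bd:
  assumes AB: "tilde_on m (K \<inter> I) (q powi s) A B" and odd: "\<And>i. i \<in> I \<Longrightarrow> par m i = 1"
    and fin: "finite K"
  shows "tilde_on m K (q powi s) (bd I 1 s A) (bd I 1 (- s) B)"
proof -
  have inv: "inverse (q powi s) = q powi (- s)" by (simp add: power_int_minus)
  show ?thesis
    using AB unfolding tilde_on_def inv
    by (auto simp: st_bd intro!: manin_on_bd inv_on_bd odd fin)
qed

text \<open>Each monomial uses every element of \<open>J\<close> once as a row and once as a column,
  so its weight cancels.\<close>

lemma rdet_bd:
  assumes "finite J" "J \<subseteq> I"
  shows "rdet J (bd I 1 s X) = mul (\<lambda>d. 0) (rdet J X)"
proof -
  have list: "prod_list (map2 (bd I 1 s X) is ks)
      = mul (\<lambda>d. sum_list (map d ks) - sum_list (map d is)) (prod_list (map2 X is ks))"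
    if "length is = length ks" "set is \<subseteq> J" "set ks \<subseteq> J" for "is" ks
    using that
  proof (induction "is" ks rule: list_induct2)
    case (Cons i "is" k ks)
    have "bd I 1 s X i k = mul (\<lambda>d. d k - d i) (X i k)"
      using Cons assms(2) by (subst bd_in) auto
    then show ?case
      using Cons by (simp add: mul_mul algebra_simps)
  qed (simp add: mul_1)
  have "prod_list (map2 (bd I 1 s X) (sorted_list_of_set J) ks)
      = mul (\<lambda>d. 0) (prod_list (map2 X (sorted_list_of_set J) ks))"
    if ks: "ks \<in> permutations_of_set J" for ks
  proof -
    have "sum_list (map d ks) = sum_list (map d (sorted_list_of_set J))" for d :: "nat \<Rightarrow> int"
      using permutations_of_setD[OF ks] assms(1) by (simp add: sum_list_distinct_conv_sum_set)
    moreover have "length (sorted_list_of_set J) = length ks"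
      using length_finite_permutations_of_set[OF ks] by simp
    ultimately show ?thesis
      using list[of "sorted_list_of_set J" ks] permutations_of_setD[OF ks] assms(1) by simp
  qed
  then show ?thesis
    unfolding rdet_permutations[OF assms(1)]
    by (simp add: mul_sum qp_def mul_sc cong: sum.cong)
qed

section \<open>Transfer of minor identities to the Schur complement\<close>

definition two_sided_unit :: "'a::monoid_mult \<Rightarrow> bool" where
  "two_sided_unit x \<longleftrightarrow> (\<exists>y. y * x = 1 \<and> x * y = 1)"

lemma two_sided_unit_mult:
  assumes "two_sided_unit x" "two_sided_unit y"
  shows "two_sided_unit (x * y)"
proof -
  obtain x' y' where *: "x' * x = 1" "x * x' = 1" "y' * y = 1" "y * y' = 1"
    using assms by (auto simp: two_sided_unit_def)
  have "(y' * x') * (x * y) = y' * (x' * x) * y" "(x * y) * (y' * x') = x * (y * y') * x'"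
    by (simp_all only: mult.assoc)
  then show ?thesis using * by (auto simp: two_sided_unit_def)
qed

lemma two_sided_unit_prod_list: "(\<And>x. x \<in> set xs \<Longrightarrow> two_sided_unit x) \<Longrightarrow> two_sided_unit (prod_list xs)"
  by (induction xs) (auto intro: two_sided_unit_mult simp: two_sided_unit_def[of 1])

lemma two_sided_unit_shift: "two_sided_unit (shift e :: 'a::cq_algebra op)"
  unfolding two_sided_unit_def
  by (rule exI[of _ "shift (\<lambda>i. - e i)"]) (simp add: shift_shift shift_0)

lemma two_sided_unit_mul: "two_sided_unit x \<Longrightarrow> two_sided_unit (mul (\<lambda>d. 0) x)"
  unfolding two_sided_unit_def
proof (elim exE)
  fix y assume "y * x = 1 \<and> x * y = 1"
  then show "\<exists>Y. Y * mul (\<lambda>d. 0) x = 1 \<and> mul (\<lambda>d. 0) x * Y = 1"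
    by (intro exI[of _ "mul (\<lambda>d. 0) y"]) (simp add: mul_mul mul_1)
qed

context universal_image_odd
begin

text \<open>The value that the Berezinian of M_K is going to take. It is written down beforehand
  because the image of the generator \<open>Ber_inv K\<close> has to be chosen as its
  inverse.\<close>

definition Ber_op :: "nat set \<Rightarrow> 'a op" where
  "Ber_op K = rdet (K \<inter> {1..m}) (\<lambda>i j. bd I 1 1 (WI I) j i)
     * rdet (K - {1..m}) (bd I 1 (-1) (MI (K \<inter> I \<union> C)))"

text \<open>With J = K \<inter> I, the twisted matrix on \<open>K\<close> consists of N_J and
  shifts, and N_J is inverted by a block of \<open>MI (J \<union> C)\<close>. For K = V this is the
  inverse of the whole matrix, and its submatrix on \<open>K\<close> is inverted through
  \<open>WI J\<close>.\<close>

fun rep_gen :: "generator \<Rightarrow> 'a op" where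
  "rep_gen (M_entry i j) = bd I 1 1 (WI I) i j"
| "rep_gen (M_sub_inv K a b) = bd I 1 (-1) (MI (K \<inter> I \<union> C)) (el K a) (el K b)"
| "rep_gen (Minv_sub_inv K a b) = bd I 1 1 (WI (K \<inter> I)) (el K a) (el K b)"
| "rep_gen (Ber_inv K) = (SOME Y. Y * Ber_op K = 1 \<and> Ber_op K * Y = 1)"

definition rep :: "generator free_alg \<Rightarrow> 'a op" where
  "rep = free_eval rep_gen"

lemma alg_hom_rep: "alg_hom rep"
  by (simp add: rep_def alg_hom_free_eval)

lemma rep_gens:
  "rep (M i j) = bd I 1 1 (WI I) i j"
  "rep (MsubInv K a b) = bd I 1 (-1) (MI (K \<inter> I \<union> C)) (el K a) (el K b)"
  "rep (MinvSubInv K a b) = bd I 1 1 (WI (K \<inter> I)) (el K a) (el K b)"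
  "rep (BerMInv K) = (SOME Y. Y * Ber_op K = 1 \<and> Ber_op K * Y = 1)"
  by (simp_all add: rep_def M_def MsubInv_def MinvSubInv_def BerMInv_def free_eval_gen)

lemma tilde_on_rep:
  assumes K: "K \<subseteq> V"
  shows "tilde_on m K q (bd I 1 1 (WI I)) (bd I 1 (-1) (MI (K \<inter> I \<union> C)))"
    and "tilde_on m K (inverse q) (bd I 1 (-1) (MI V)) (bd I 1 1 (WI (K \<inter> I)))"
proof -
  show "tilde_on m K q (bd I 1 1 (WI I)) (bd I 1 (-1) (MI (K \<inter> I \<union> C)))"
    using tilde_on_bd[of m K I 1 "WI I" "MI (K \<inter> I \<union> C)"] tilde_quasi[of "K \<inter> I"]
      par_I finite_sub_V[OF K] by simp
  show "tilde_on m K (inverse q) (bd I 1 (-1) (MI V)) (bd I 1 1 (WI (K \<inter> I)))"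
    using tilde_on_bd[of m K I "-1" "MI V" "WI (K \<inter> I)"] tilde_Minv[of "K \<inter> I"]
      par_I finite_sub_V[OF K] K by (auto simp: power_int_minus)
qed

lemma rep_BerM:
  assumes K: "K \<subseteq> V"
  shows "rep (BerM m K) = Ber_op K"
  unfolding BerM_def Ber_op_def
  by (rule alg_hom_Ber[OF alg_hom_rep finite_sub_V[OF K] zero_sub_V[OF K]])
     (auto simp: submat_def el_def[symmetric] rep_gens simp del: One_nat_def)

text \<open>By the factorization this is a quotient of two Berezinians of \<open>M\<close>, which
  are invertible by the standing conventions.\<close>

lemma two_sided_unit_rdet:
  assumes "J \<subseteq> I"
  shows "two_sided_unit (rdet J (MI (J \<union> C)))"
proof -
  have JC: "J \<union> C \<subseteq> V" using assms I_V C_V by blast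
  let ?c = "f (BerM m C)" and ?c' = "f (BerMInv C)"
    and ?d = "f (BerM m (J \<union> C))" and ?d' = "f (BerMInv (J \<union> C))"
  have r: "rdet J (MI (J \<union> C)) = ?c' * ?d"
    using f_BerM_union[OF assms] f_BerMInv[OF C_V] by (simp flip: mult.assoc)
  have "two_sided_unit ?c'" "two_sided_unit ?d"
    using f_BerMInv[OF C_V] f_BerMInv[OF JC] by (auto simp: two_sided_unit_def)
  then show ?thesis unfolding r by (rule two_sided_unit_mult)
qed

text \<open>The even factor and the odd indices outside \<open>I\<close> contribute only products of
  shifts; the rest is the determinant over \<open>K \<inter> I\<close>.\<close>

lemma two_sided_unit_Ber_op:
  assumes K: "K \<subseteq> V"
  shows "two_sided_unit (Ber_op K)"
proof -
  let ?X = "bd I 1 (-1) (MI (K \<inter> I \<union> C))" and ?O = "K - {1..m} - I"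
  have fin: "finite K" "finite ?O" "finite (K \<inter> I)" using finite_sub_V[OF K] by auto
  have diag: "two_sided_unit (rdet S Y)"
    if "finite S" "\<And>i j. i \<in> S \<Longrightarrow> j \<in> S \<Longrightarrow> i \<noteq> j \<Longrightarrow> Y i j = 0" "\<And>i. i \<in> S \<Longrightarrow> two_sided_unit (Y i i)"
    for S and Y :: "'a op mat"
  proof -
    have "rdet S Y = prod_list (map (\<lambda>i. Y i i) (sorted_list_of_set S))"
      by (rule rdet_diagonal) (use that in auto)
    moreover have "two_sided_unit (prod_list (map (\<lambda>i. Y i i) (sorted_list_of_set S)))"
      by (rule two_sided_unit_prod_list) (use that in auto)
    ultimately show ?thesis by simp
  qed
  have bd_unit: "two_sided_unit (bd I 1 s Y i i)" if "i \<notin> I" for s Y i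
    using that by (simp add: bd_diag two_sided_unit_shift)
  have "two_sided_unit (rdet (K \<inter> {1..m}) (\<lambda>i j. bd I 1 1 (WI I) j i))"
    by (rule diag) (use fin I in \<open>auto intro!: bd_off bd_unit\<close>)
  moreover have "two_sided_unit (rdet (K - {1..m}) ?X)"
  proof -
    \<comment> \<open>The matrix is already block diagonal, so the elimination coefficients are
      0.\<close>
    have "rdet (?O \<union> (K \<inter> I)) ?X = rdet ?O ?X * rdet (K \<inter> I) ?X"
    proof (rule rdet_schur[where c = "\<lambda>_ _. 0"])
      have "manin_on m (?O \<union> (K \<inter> I)) (inverse q) ?X"
        using tilde_on_rep(1)[OF K] by (auto simp: tilde_on_def intro: manin_on_mono)
      moreover have "par m i = 1" if "i \<in> ?O \<union> (K \<inter> I)" for i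
      proof (cases "i \<in> I")
        case False
        then show ?thesis using that K by (auto simp: par_def V_def)
      qed (rule par_I)
      ultimately show "qrows (?O \<union> (K \<inter> I)) (?O \<union> (K \<inter> I)) ?X" by (rule manin_on_qrows)
    qed (use fin in \<open>auto intro!: bd_off\<close>)
    moreover have "?O \<union> (K \<inter> I) = K - {1..m}" using I by auto
    moreover have "two_sided_unit (rdet ?O ?X)"
      by (rule diag) (use fin in \<open>auto intro!: bd_off bd_unit\<close>)
    moreover have "two_sided_unit (rdet (K \<inter> I) ?X)"
      using rdet_bd[OF fin(3), of I "-1" "MI (K \<inter> I \<union> C)"] two_sided_unit_rdet[of "K \<inter> I"] by (simp add: two_sided_unit_mul)
    ultimately show ?thesis by (metis two_sided_unit_mult)
  qed
  ultimately show ?thesis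
    unfolding Ber_op_def by (rule two_sided_unit_mult)
qed

text \<open>Hence \<open>rep\<close> factors through the presented algebra, and every identity that
  holds universally holds for the operators.\<close>

lemma rep_rels:
  assumes "x \<in> universal_rels m n"
  shows "rep x = 0"
proof -
  obtain K where K: "K \<subseteq> V" and x:
    "x \<in> tilde_rels (num_even m K) (num_odd m K) q (submat K M) (MsubInv K)
     \<or> x \<in> tilde_rels (num_even m K) (num_odd m K) (inverse q) (submat K (Minv m n)) (MinvSubInv K)
     \<or> x = BerM m K * BerMInv K - 1 \<or> x = BerMInv K * BerM m K - 1"
    using assms unfolding universal_rels_def V_def by auto
  note K' = finite_sub_V[OF K] zero_sub_V[OF K]
  have "\<forall>x \<in> tilde_rels (num_even m K) (num_odd m K) q (submat K M) (MsubInv K). rep x = 0"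
    by (subst tilde_rels_iff[OF alg_hom_rep K', where A = "bd I 1 1 (WI I)"
          and B = "bd I 1 (-1) (MI (K \<inter> I \<union> C))"])
       (auto simp: submat_def el_def[symmetric] rep_gens tilde_on_rep[OF K] simp del: One_nat_def)
  moreover have "\<forall>x \<in> tilde_rels (num_even m K) (num_odd m K) (inverse q)
      (submat K (Minv m n)) (MinvSubInv K). rep x = 0"
  proof (subst tilde_rels_iff[OF alg_hom_rep K', where A = "bd I 1 (-1) (MI V)"
          and B = "bd I 1 1 (WI (K \<inter> I))"])
    fix a b assume ab: "a \<in> {1..card K}" "b \<in> {1..card K}"
    have "el K a \<in> V" "el K b \<in> V" using ab el_in[OF K'(1)] K by blast+
    moreover have "V \<inter> I \<union> C = V" using I_V C_V by (auto simp: C_def)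
    ultimately show "rep (submat K (Minv m n) a b) = bd I 1 (-1) (MI V) (el K a) (el K b)"
      by (simp add: submat_def el_def[symmetric] Minv_def rep_gens el_V V_def[symmetric]
          del: One_nat_def)
  qed (auto simp: rep_gens tilde_on_rep[OF K] simp del: One_nat_def)
  moreover have "rep (BerMInv K) * Ber_op K = 1 \<and> Ber_op K * rep (BerMInv K) = 1"
    unfolding rep_gens by (rule someI_ex) (use two_sided_unit_Ber_op[OF K] in \<open>simp add: two_sided_unit_def\<close>)
  then have "rep (BerM m K * BerMInv K - 1) = 0" "rep (BerMInv K * BerM m K - 1) = 0"
    by (simp_all add: alg_hom_diff[OF alg_hom_rep] alg_hom_mult[OF alg_hom_rep]
        alg_hom_1[OF alg_hom_rep] rep_BerM[OF K])
  ultimately show ?thesis using x by blast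
qed

lemma rep_BerM_sub:
  assumes "J \<subseteq> I"
  shows "rep (BerM m J) = mul (\<lambda>d. 0) (rdet J (MI (J \<union> C)))"
proof -
  have "J \<inter> {1..m} = {}" "J - {1..m} = J" "J \<inter> I = J" using assms I by auto
  moreover have "finite J" "J \<subseteq> V" using assms I_V finite_sub_V by blast+
  ultimately show ?thesis
    using assms by (simp add: rep_BerM Ber_op_def rdet_bd)
qed

lemma prod_list_conjugate:
  fixes u v :: "'b::monoid_mult"
  assumes "v * u = 1" "u * v = 1"
  shows "prod_list (map (\<lambda>x. u * x * v) xs) = u * prod_list xs * v"
proof (induction xs)
  case (Cons x xs)
  have "u * x * v * (u * prod_list xs * v) = u * x * (v * u) * prod_list xs * v"
    by (simp only: mult.assoc)
  then show ?case using Cons assms by (simp add: mult.assoc)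
qed (use assms in simp)

text \<open>The operators turn the assumption into the same identity for the determinants
  \<open>r i j\<close>; conjugation by Ber(M_C) turns that into the conclusion, since inner factors
  cancel in each product.\<close>

theorem f_muir:
  fixes k :: nat and mult :: "nat \<Rightarrow> nat"
  assumes J: "\<And>i j. i \<in> {1..k} \<Longrightarrow> j \<in> {1..mult i} \<Longrightarrow> J i j \<subseteq> I"
    and id: "(\<Sum>i=1..k. scal (b i) * (\<Prod>j\<leftarrow>[1..<Suc (mult i)]. BerM m (J i j)))
      \<in> two_sided_ideal (universal_rels m n)"
  shows "f (\<Sum>i=1..k. scal (b i) * (\<Prod>j\<leftarrow>[1..<Suc (mult i)].
           BerM m (J i j \<union> C) * BerMInv C)) = 0"
proof -
  define r where "r i j = rdet (J i j) (MI (J i j \<union> C))" for i j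
  have J': "J i j \<subseteq> I" if "i \<in> {1..k}" "j \<in> set [1..<Suc (mult i)]" for i j
    using that by (intro J) auto
  have "rep (\<Sum>i=1..k. scal (b i) * (\<Prod>j\<leftarrow>[1..<Suc (mult i)]. BerM m (J i j)))
    = mul (\<lambda>d. 0) (\<Sum>i=1..k. sc (b i) * (\<Prod>j\<leftarrow>[1..<Suc (mult i)]. r i j))"
    unfolding alg_hom_sum[OF alg_hom_rep] alg_hom_mult[OF alg_hom_rep] alg_hom_scal[OF alg_hom_rep]
      alg_hom_prod_list[OF alg_hom_rep] mul_sum mul_sc mul_prod_list map_map comp_def
    by (intro sum.cong refl arg_cong2[where f = "(*)"] arg_cong[where f = prod_list] map_cong)
       (use J' rep_BerM_sub in \<open>simp add: r_def\<close>)
  \<comment> \<open>Weight 0 multiplications are faithful, so the identity descends from operators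
    to the algebra itself.\<close>
  then have zero: "(\<Sum>i=1..k. sc (b i) * (\<Prod>j\<leftarrow>[1..<Suc (mult i)]. r i j)) = 0"
    using alg_hom_ideal[OF alg_hom_rep rep_rels id] by (simp add: mul_eq_0D)
  let ?u = "f (BerM m C)" and ?v = "f (BerMInv C)"
  have uv: "?v * ?u = 1" "?u * ?v = 1" using f_BerMInv[OF C_V] by auto
  have "f (\<Sum>i=1..k. scal (b i) * (\<Prod>j\<leftarrow>[1..<Suc (mult i)]. BerM m (J i j \<union> C) * BerMInv C))
    = (\<Sum>i=1..k. sc (b i) * (\<Prod>j\<leftarrow>[1..<Suc (mult i)]. ?u * r i j * ?v))"
    unfolding alg_hom_sum[OF hom] alg_hom_mult[OF hom] alg_hom_scal[OF hom]
      alg_hom_prod_list[OF hom] map_map comp_def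
    by (intro sum.cong refl arg_cong2[where f = "(*)"] arg_cong[where f = prod_list] map_cong)
       (use J' f_BerM_union in \<open>simp add: r_def\<close>)
  also have "\<dots> = (\<Sum>i=1..k. ?u * (sc (b i) * (\<Prod>j\<leftarrow>[1..<Suc (mult i)]. r i j)) * ?v)"
  proof (rule sum.cong[OF refl])
    fix i
    show "sc (b i) * (\<Prod>j\<leftarrow>[1..<Suc (mult i)]. ?u * r i j * ?v)
        = ?u * (sc (b i) * (\<Prod>j\<leftarrow>[1..<Suc (mult i)]. r i j)) * ?v"
      using prod_list_conjugate[OF uv, of "map (r i) [1..<Suc (mult i)]"]
      by (simp add: comp_def sc_left_commute[of ?u] mult.assoc del: upt_Suc)
  qed
  also have "\<dots> = ?u * (\<Sum>i=1..k. sc (b i) * (\<Prod>j\<leftarrow>[1..<Suc (mult i)]. r i j)) * ?v"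
    by (simp add: sum_distrib_left sum_distrib_right)
  finally show ?thesis unfolding zero by simp
qed

end

section \<open>The presented algebra as a type\<close>

lemma two_sided_ideal_mult:
  assumes "x \<in> two_sided_ideal S"
  shows "a * x * b \<in> two_sided_ideal S"
  using assms
proof induction
  case zero
  then show ?case by (simp add: two_sided_ideal.zero)
next
  case (base s c d)
  have "a * (c * s * d) * b = (a * c) * s * (d * b)" by (simp add: mult.assoc)
  then show ?case using base two_sided_ideal.base by metis
next
  case (add x y)
  have "a * (x + y) * b = a * x * b + a * y * b" by (simp add: algebra_simps)
  then show ?case using add two_sided_ideal.add by metis
qed

lemma two_sided_ideal_uminus: "x \<in> two_sided_ideal S \<Longrightarrow> - x \<in> two_sided_ideal S"
  using two_sided_ideal_mult[of x S "-1" 1] by simp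

lemma two_sided_ideal_empty: "x \<in> two_sided_ideal {} \<Longrightarrow> x = 0"
  by (induction rule: two_sided_ideal.induct) auto

lemma two_sided_ideal_trivial: "1 \<in> two_sided_ideal S \<Longrightarrow> x \<in> two_sided_ideal S"
  using two_sided_ideal_mult[of 1 S x 1] by simp

text \<open>The theorem for one pair as a closed predicate, so that a failing pair can be chosen by
  description.\<close>

definition muir :: "nat \<Rightarrow> nat \<Rightarrow> bool" where
  "muir m n \<longleftrightarrow> (\<forall>(k :: nat) I b (mult :: nat \<Rightarrow> nat) (J :: nat \<Rightarrow> nat \<Rightarrow> nat set). I \<subseteq> {1..m+n} - {1..m} \<longrightarrow>
     (\<forall>i j. i \<in> {1..k} \<longrightarrow> j \<in> {1..mult i} \<longrightarrow> J i j \<subseteq> I) \<longrightarrow>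
     holds_universally m n
           (\<Sum>i=1..k. scal (b i) * (\<Prod>j\<leftarrow>[1..<Suc (mult i)]. BerM m (J i j))) 0 \<longrightarrow>
     holds_universally m n
           (\<Sum>i=1..k. scal (b i) * (\<Prod>j\<leftarrow>[1..<Suc (mult i)].
              BerM m (J i j \<union> ({1..m+n} - I)) * BerMInv ({1..m+n} - I))) 0)"

lemma muir_trivial: "1 \<in> two_sided_ideal (universal_rels m n) \<Longrightarrow> muir m n"
  by (simp add: muir_def holds_universally_def two_sided_ideal_trivial)

text \<open>A type cannot depend on the variables \<open>m\<close> and \<open>n\<close>. The quotient algebra is therefore formed
  for one fixed pair, chosen to violate the theorem if any pair does. The relations are dropped when
  that choice is void, so that \<open>0 \<noteq> 1\<close> in the quotient in every case.\<close>

definition bad_m :: nat where "bad_m = fst (SOME (m, n). \<not> muir m n)"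

definition bad_n :: nat where "bad_n = snd (SOME (m, n). \<not> muir m n)"

lemma muir_bad: "muir bad_m bad_n \<Longrightarrow> muir m n"
proof (rule ccontr)
  assume "muir bad_m bad_n" "\<not> muir m n"
  then have "case (m, n) of (m, n) \<Rightarrow> \<not> muir m n" by simp
  then have "case (SOME (m, n). \<not> muir m n) of (m, n) \<Rightarrow> \<not> muir m n" by (rule someI)
  then show False
    using \<open>muir bad_m bad_n\<close> by (simp add: bad_m_def bad_n_def case_prod_unfold)
qed

definition bad_ideal :: "generator free_alg set" where
  "bad_ideal = two_sided_ideal (if muir bad_m bad_n then {} else universal_rels bad_m bad_n)"

text \<open>Either no relations are imposed, or the theorem fails for the chosen pair; in the latter
  case 1 is not in the ideal, since otherwise every identity would hold.\<close>

lemma one_notin_bad_ideal: "1 \<notin> bad_ideal"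
  using muir_trivial two_sided_ideal_empty[of "1 :: generator free_alg"]
  by (auto simp: bad_ideal_def)

lemma bad_ideal_closed:
  "0 \<in> bad_ideal"
  "x \<in> bad_ideal \<Longrightarrow> y \<in> bad_ideal \<Longrightarrow> x + y \<in> bad_ideal"
  "x \<in> bad_ideal \<Longrightarrow> - x \<in> bad_ideal"
  "x \<in> bad_ideal \<Longrightarrow> a * x * b \<in> bad_ideal"
  by (simp_all add: bad_ideal_def two_sided_ideal.zero two_sided_ideal.add two_sided_ideal_uminus
      two_sided_ideal_mult)

quotient_type bad_alg = "generator free_alg" / "\<lambda>x y. x - y \<in> bad_ideal"
proof (rule equivpI)
  show "reflp (\<lambda>x y. x - y \<in> bad_ideal)"
    by (simp add: reflp_def bad_ideal_closed)
  show "symp (\<lambda>x y. x - y \<in> bad_ideal)"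
    by (rule sympI) (use bad_ideal_closed(3) in fastforce)
  show "transp (\<lambda>x y. x - y \<in> bad_ideal)"
  proof (rule transpI)
    fix x y z assume "x - y \<in> bad_ideal" "y - z \<in> bad_ideal"
    then show "x - z \<in> bad_ideal" using bad_ideal_closed(2)[of "x - y" "y - z"] by simp
  qed
qed

instantiation bad_alg :: cq_algebra
begin

lift_definition zero_bad_alg :: bad_alg is 0 .
lift_definition one_bad_alg :: bad_alg is 1 .
lift_definition plus_bad_alg :: "bad_alg \<Rightarrow> bad_alg \<Rightarrow> bad_alg" is "(+)"
proof -
  fix a b c d assume "a - b \<in> bad_ideal" "c - d \<in> bad_ideal"
  then show "a + c - (b + d) \<in> bad_ideal"
    using bad_ideal_closed(2)[of "a - b" "c - d"] by (simp add: algebra_simps)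
qed
lift_definition uminus_bad_alg :: "bad_alg \<Rightarrow> bad_alg" is uminus
proof -
  fix a b assume "a - b \<in> bad_ideal"
  then show "- a - - b \<in> bad_ideal" using bad_ideal_closed(3)[of "a - b"] by simp
qed
lift_definition minus_bad_alg :: "bad_alg \<Rightarrow> bad_alg \<Rightarrow> bad_alg" is "(-)"
proof -
  fix a b c d assume "a - b \<in> bad_ideal" "c - d \<in> bad_ideal"
  then show "a - c - (b - d) \<in> bad_ideal"
    using bad_ideal_closed(2)[of "a - b" "- (c - d)"] bad_ideal_closed(3)[of "c - d"]
    by (simp add: algebra_simps)
qed
lift_definition times_bad_alg :: "bad_alg \<Rightarrow> bad_alg \<Rightarrow> bad_alg" is "(*)"
proof -
  fix a b c d assume "a - b \<in> bad_ideal" "c - d \<in> bad_ideal"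
  then have "1 * (a - b) * c + b * (c - d) * 1 \<in> bad_ideal"
    by (intro bad_ideal_closed(2,4))
  then show "a * c - b * d \<in> bad_ideal" by (simp add: algebra_simps)
qed
lift_definition sc_bad_alg :: "Cq \<Rightarrow> bad_alg" is scal .

instance
proof
  have scal_commute: "x * scal a = scal a * x" for x :: "generator free_alg" and a
  proof (induction x rule: update_induct)
    case (update x w c)
    have "Poly_Mapping.update w c x = Poly_Mapping.single w c + x"
      using update by (intro poly_mapping_eqI)
        (auto simp: lookup_update lookup_add lookup_single in_keys_iff when_def)
    then show ?case
      using update by (simp add: algebra_simps scal_def mult_single)
  qed simp
  fix x y z :: bad_alg and a b :: Cq
  note refl = bad_ideal_closed(1)
  show "x * y * z = x * (y * z)" by transfer (simp add: mult.assoc refl)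
  show "x + y + z = x + (y + z)" by transfer (simp add: add.assoc refl)
  show "x + y = y + x" by transfer (simp add: add.commute refl)
  show "0 + x = x" by transfer (simp add: refl)
  show "- x + x = 0" by transfer (simp add: refl)
  show "x - y = x + - y" by transfer (simp add: refl)
  show "1 * x = x" "x * 1 = x" by (transfer, simp add: refl)+
  show "(x + y) * z = x * z + y * z" by transfer (simp add: distrib_right refl)
  show "x * (y + z) = x * y + x * z" by transfer (simp add: distrib_left refl)
  show "(0::bad_alg) \<noteq> 1"
    using one_notin_bad_ideal bad_ideal_closed(3)[of "- 1"] by transfer auto
  show "sc (a + b) = (sc a + sc b :: bad_alg)"
    by transfer (simp add: scal_def single_add refl)
  show "sc (a * b) = (sc a * sc b :: bad_alg)"
    by transfer (simp add: scal_def mult_single refl)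
  show "sc 1 = (1 :: bad_alg)"
    by transfer (simp add: scal_def refl)
  show "x * sc a = sc a * x"
    by transfer (simp add: scal_commute refl)
qed

end

lemma alg_hom_abs_bad_alg: "alg_hom abs_bad_alg"
  by (simp add: alg_hom_def plus_bad_alg.abs_eq times_bad_alg.abs_eq sc_bad_alg.abs_eq)

lemma abs_bad_alg_eq_0_iff: "abs_bad_alg x = 0 \<longleftrightarrow> x \<in> bad_ideal"
  by (simp add: zero_bad_alg_def bad_alg.abs_eq_iff)

text \<open>If the theorem failed, the quotient type would be the true presented algebra of a
  failing pair; but its quotient map satisfies the locale assumptions, which yields the theorem for
  that pair.\<close>

lemma muir_holds: "muir m n"
proof (rule muir_bad, rule ccontr)
  assume bad: "\<not> muir bad_m bad_n"
  then have ideal: "bad_ideal = two_sided_ideal (universal_rels bad_m bad_n)"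
    by (simp add: bad_ideal_def)
  have "muir bad_m bad_n"
    unfolding muir_def
  proof (intro allI impI)
    fix k I b and mult :: "nat \<Rightarrow> nat" and J :: "nat \<Rightarrow> nat \<Rightarrow> nat set"
    assume I: "I \<subseteq> {1..bad_m + bad_n} - {1..bad_m}"
      and J: "\<forall>i j. i \<in> {1..k} \<longrightarrow> j \<in> {1..mult i} \<longrightarrow> J i j \<subseteq> I"
      and id: "holds_universally bad_m bad_n
           (\<Sum>i=1..k. scal (b i) * (\<Prod>j\<leftarrow>[1..<Suc (mult i)]. BerM bad_m (J i j))) 0"
    interpret universal_image_odd bad_m bad_n abs_bad_alg I
    proof
      fix x assume "x \<in> universal_rels bad_m bad_n"
      then have "1 * x * 1 \<in> bad_ideal" unfolding ideal by (rule two_sided_ideal.base)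
      then show "abs_bad_alg x = 0" by (simp add: abs_bad_alg_eq_0_iff)
    qed (use I alg_hom_abs_bad_alg in auto)
    have "abs_bad_alg (\<Sum>i=1..k. scal (b i) * (\<Prod>j\<leftarrow>[1..<Suc (mult i)].
           BerM bad_m (J i j \<union> C) * BerMInv C)) = 0"
      by (rule f_muir) (use J id in \<open>auto simp: holds_universally_def\<close>)
    then show "holds_universally bad_m bad_n
           (\<Sum>i=1..k. scal (b i) * (\<Prod>j\<leftarrow>[1..<Suc (mult i)].
              BerM bad_m (J i j \<union> ({1..bad_m + bad_n} - I)) * BerMInv ({1..bad_m + bad_n} - I))) 0"
      by (simp add: abs_bad_alg_eq_0_iff ideal holds_universally_def C_def V_def del: upt_Suc)
  qed
  with bad show False ..
qed

theorem theorem4p9: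
  fixes m n k :: nat
    and I :: "nat set"
    and b :: "nat \<Rightarrow> Cq"
    and mult :: "nat \<Rightarrow> nat"
    and J :: "nat \<Rightarrow> nat \<Rightarrow> nat set"
  assumes "I \<subseteq> {1..m+n} - {1..m}"
    and "\<And>i j. i \<in> {1..k} \<Longrightarrow> j \<in> {1..mult i} \<Longrightarrow> J i j \<subseteq> I"
    and "holds_universally m n
           (\<Sum>i=1..k. scal (b i) * (\<Prod>j\<leftarrow>[1..<Suc (mult i)]. BerM m (J i j))) 0"
  shows "holds_universally m n
           (\<Sum>i=1..k. scal (b i) * (\<Prod>j\<leftarrow>[1..<Suc (mult i)].
              BerM m (J i j \<union> ({1..m+n} - I)) * BerMInv ({1..m+n} - I))) 0"
  using muir_holds[of m n, unfolded muir_def, rule_format, of I k mult J b] assms by blast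

end
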